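(* Let $p\ge 2$ be an integer and $n$ a positive even integer, and let $U_{p,n}/{\sim}$ denote the set of equivalence classes of $U_{p,n}=\mathbb Z_p^n$ under the relation $\sim$. (1) Let $n=2$. (i) If $p$ is odd, then $U_{p,2}/{\sim}=\{U_{p,2}\}$. (ii) If $p$ is even, then $U_{p,2}/{\sim}=\{\eta_\varepsilon \mid \varepsilon\in\{0,1\}\}$, where $\eta_\varepsilon=\{\boldsymbol a\in U_{p,2}\mid \varepsilon_p(\boldsymbol a)=\varepsilon\}$. (2) Let $n$ be an even integer greater than $2$. (i) If $p$ is odd, then $U_{p,n}/{\sim}=\{\delta_\tau \mid \tau\in\{1,\ldots,p\},\ \tau|p\}$, where $\delta_\tau=\{\boldsymbol a\in U_{p,n}\mid \tau_p(\boldsymbol a)=\tau\}$. (ii) If $p$ is even, then $U_{p,n}/{\sim}$ is the union of the following three sets: - $\{\alpha_{\tau,\mu}\}$, where $\tau$ ranges over $\tau\in\{1,\ldots,p\}$ with $\tau|p$ and $\tau$ odd, and $\mu$ ranges over integers with $-n<\mu<n$, $\mu\equiv 0\pmod 2$ and $\frac{n-|\mu|}{2}\equiv 0\pmod 2$; - $\{\beta_{\tau,\varepsilon}\}$, where $\tau$ ranges over $\tau\in\{1,\ldots,p\}$ with $\tau|p$, $\tau$ even and $\frac p\tau$ odd, and $\varepsilon\in\{0,1\}$; - $\{\gamma_{\tau,\varepsilon,\mu}\}$, where $\tau$ ranges over $\tau\in\{1,\ldots,p\}$ with $\tau|p$, $\tau$ even and $\frac p\tau$ even, $\varepsilon\in\{0,1\}$,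 and $\mu$ ranges over integers with $0\le\mu<n$, $\mu\equiv 0\pmod 2$ and $\frac{n-|\mu|}{2}\equiv 0\pmod 2$; where $$\alpha_{\tau,\mu}=\{\boldsymbol a\in U_{p,n}\mid \tau_p(\boldsymbol a)=\tau,\ \mu_p(\boldsymbol a)=\mu\},$$ $$\beta_{\tau,\varepsilon}=\{\boldsymbol a\in U_{p,n}\mid \tau_p(\boldsymbol a)=\tau,\ \varepsilon_p(\boldsymbol a)=\varepsilon\},$$ $$\gamma_{\tau,\varepsilon,\mu}=\{\boldsymbol a\in U_{p,n}\mid \tau_p(\boldsymbol a)=\tau,\ \varepsilon_p(\boldsymbol a)=\varepsilon,\ \mu_{p,\tau}(\boldsymbol a)=\mu\}.$$
   Context: $\mathbb Z_p=\{0,1,\ldots,p-1\}$ is the cyclic group $\mathbb Z/p\mathbb Z$. For a positive even integer $n$, $U_{p,n}=\mathbb Z_p^n$, and $U_p=\bigcup_{n\in 2\mathbb Z_+}U_{p,n}$. Equivalence $\sim$: two elements of $U_p$ are equivalent if they are related by a finite sequence of the following transformations. (Op1) $(a_1,\ldots,a_n)\to(a_2,\ldots,a_n,a_1)$; (Op2) $(a_1,\ldots,a_n)\to(a,\,a_2+(-1)^2(a_1-a),\ldots,a_i+(-1)^i(a_1-a),\ldots,a_n+(-1)^n(a_1-a))$ for $a\in\mathbb Z_p$; (Op3) $(a_1,\ldots,a_n)\to(a,\,a_1-a_2+a,\ldots,a_1-a_i+a,\ldots,a_1-a_n+a)$ for $a\in\mathbb Z_p$; (Op4) if $n>2$: $(a_1,\ldots,a_n)\to(a_1,\,-a_1+a_2+a_3,\,a_3,\ldots,a_n)$.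 (Each of these transformations has an inverse obtained by composing such transformations, and $\sim$ restricts to each $U_{p,n}$.) In the following definitions, for $\boldsymbol a=(a_1,\ldots,a_n)\in U_p$ the entries $a_i\in\{0,\ldots,p-1\}$ are treated as integers. $\tau_p(\boldsymbol a)=\max\{k\in\{1,\ldots,p\}\mid k|p,\ a_1+a_2\equiv a_2+a_3\equiv\cdots\equiv a_n+a_1\pmod k\}$. For $p$ even: $\varepsilon_p(\boldsymbol a)=0$ if $a_1+a_2\equiv\cdots\equiv a_n+a_1\equiv 0\pmod 2$; $\varepsilon_p(\boldsymbol a)=1$ if $a_1+a_2\equiv\cdots\equiv a_n+a_1\equiv 1\pmod 2$; $\varepsilon_p(\boldsymbol a)=\infty$ otherwise. For $p$ even: $\mu_p(\boldsymbol a)$ is the number of even entries minus the number of odd entries of the $n$-tuple $(a_1+a_2,a_2+a_3,\ldots,a_{n-1}+a_n,a_n+a_1)$. For $p$ even and $\tau\in\{1,\ldots,p\}$ with $\tau$ even, $\tau|p$ and $\frac p\tau$ even: if $\tau_p(\boldsymbol a)=\tau$, then $$\mu_{p,\tau}(\boldsymbol a)=\Big|\,\mu_{p/\tau}\Big(\big(\tfrac{a_1-a_1}{\tau},\tfrac{a_2-a_2}{\tau},\ldots,\tfrac{a_{2j-1}-a_1}{\tau},\tfrac{a_{2j}-a_2}{\tau},\ldots,\tfrac{a_n-a_2}{\tau}\big)\Big)\Big|,$$ where the entries (which are integers) are regarded modulo the even number $p/\tau$ (so their parities are well defined); if $\tau_p(\boldsymbol a)\ne\tau$, then $\mu_{p,\tau}(\boldsymbol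 a)=\infty$. *)

theory Defs
  imports "HOL-Number_Theory.Cong" "HOL-Library.Extended_Nat"
begin

text \<open>
  A tuple \<open>(a\<^sub>1, \<dots>, a\<^sub>n)\<close> over \<open>\<int>\<^sub>p = {0, \<dots>, p - 1}\<close> is an integer list of length \<open>n\<close> with entries
  in \<open>{0..<p}\<close>; the entry \<open>a\<^sub>i\<close> is \<open>a ! (i - 1)\<close>. Arithmetic in \<open>\<int>\<^sub>p\<close> is integer arithmetic followed
  by reduction \<open>mod p\<close>.
\<close>

definition U :: "int \<Rightarrow> nat \<Rightarrow> int list set" where
  "U p n = {a. length a = n \<and> set a \<subseteq> {0..<p}}"

definition U_all :: "int \<Rightarrow> int list set" where
  "U_all p = (\<Union>n\<in>{n. 0 < n \<and> even n}. U p n)"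

text \<open>
  The list index \<open>i\<close> in the rules below belongs to the entry \<open>a\<^sub>i\<^sub>+\<^sub>1\<close>, so the sign \<open>(-1)\<^sup>i\<close> of the
  entry \<open>a\<^sub>i\<close> becomes \<open>(-1) ^ (i + 1)\<close>.
\<close>

inductive op_step :: "int \<Rightarrow> int list \<Rightarrow> int list \<Rightarrow> bool" for p :: int where
  Op1: "a \<in> U_all p \<Longrightarrow> op_step p a (rotate1 a)"
| Op2: "a \<in> U_all p \<Longrightarrow> c \<in> {0..<p} \<Longrightarrow>
    op_step p a (c # map (\<lambda>i. (a ! i + (- 1) ^ (i + 1) * (a ! 0 - c)) mod p) [1..<length a])"
| Op3: "a \<in> U_all p \<Longrightarrow> c \<in> {0..<p} \<Longrightarrow>
    op_step p a (c # map (\<lambda>i. (a ! 0 - a ! i + c) mod p) [1..<length a])"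
| Op4: "a \<in> U_all p \<Longrightarrow> length a > 2 \<Longrightarrow>
    op_step p a (a[1 := (- (a ! 0) + a ! 1 + a ! 2) mod p])"

definition sim :: "int \<Rightarrow> (int list \<times> int list) set" where
  "sim p = {(a, b). a \<in> U_all p \<and> b \<in> U_all p \<and> (op_step p)\<^sup>*\<^sup>* a b}"

text \<open>The tuple \<open>(a\<^sub>1 + a\<^sub>2, a\<^sub>2 + a\<^sub>3, \<dots>, a\<^sub>n + a\<^sub>1)\<close>, with the sums taken in \<open>\<int>\<close>.\<close>

definition cyc_sums :: "int list \<Rightarrow> int list" where
  "cyc_sums a = map2 (+) a (rotate1 a)"

definition tau :: "int \<Rightarrow> int list \<Rightarrow> int" where
  "tau p a = Max {k \<in> {1..p}. k dvd p \<and>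
     (\<forall>s \<in> set (cyc_sums a). \<forall>t \<in> set (cyc_sums a). [s = t] (mod k))}"

text \<open>
  \<open>\<epsilon>\<^sub>p\<close> and \<open>\<mu>\<^sub>p\<close> depend on \<open>p\<close> only through the choice of the representatives \<open>a\<^sub>i\<close>.
\<close>

definition eps :: "int list \<Rightarrow> enat" where
  "eps a =
     (if \<forall>s \<in> set (cyc_sums a). [s = 0] (mod 2) then 0
      else if \<forall>s \<in> set (cyc_sums a). [s = 1] (mod 2) then 1
      else \<infinity>)"

definition mu :: "int list \<Rightarrow> int" where
  "mu a = int (length (filter even (cyc_sums a))) - int (length (filter odd (cyc_sums a)))"

text \<open>
  \<open>i mod 2\<close> is the list index of \<open>a\<^sub>1\<close> for the entries \<open>a\<^sub>2\<^sub>j\<^sub>-\<^sub>1\<close> and of \<open>a\<^sub>2\<close> for the entries \<open>a\<^sub>2\<^sub>j\<close>.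
  The divisions by \<open>t\<close> are exact when \<open>tau p a = t\<close>.
\<close>

definition reduced :: "int \<Rightarrow> int \<Rightarrow> int list \<Rightarrow> int list" where
  "reduced p t a = map (\<lambda>i. ((a ! i - a ! (i mod 2)) div t) mod (p div t)) [0..<length a]"

definition mu_tau :: "int \<Rightarrow> int \<Rightarrow> int list \<Rightarrow> enat" where
  "mu_tau p t a = (if tau p a = t then enat (nat \<bar>mu (reduced p t a)\<bar>) else \<infinity>)"

definition eta_class :: "int \<Rightarrow> enat \<Rightarrow> int list set" where
  "eta_class p e = {a \<in> U p 2. eps a = e}"

definition delta_class :: "int \<Rightarrow> nat \<Rightarrow> int \<Rightarrow> int list set" where
  "delta_class p n t = {a \<in> U p n. tau p a = t}"

definition alpha_class :: "int \<Rightarrow> nat \<Rightarrow> int \<Rightarrow> int \<Rightarrow> int list set" where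
  "alpha_class p n t m = {a \<in> U p n. tau p a = t \<and> mu a = m}"

definition beta_class :: "int \<Rightarrow> nat \<Rightarrow> int \<Rightarrow> enat \<Rightarrow> int list set" where
  "beta_class p n t e = {a \<in> U p n. tau p a = t \<and> eps a = e}"

text \<open>Only used for \<open>m \<ge> 0\<close>, where \<open>nat m\<close> is \<open>m\<close> itself.\<close>

definition gamma_class :: "int \<Rightarrow> nat \<Rightarrow> int \<Rightarrow> enat \<Rightarrow> int \<Rightarrow> int list set" where
  "gamma_class p n t e m =
     {a \<in> U p n. tau p a = t \<and> eps a = e \<and> mu_tau p t a = enat (nat m)}"

end

theory Submission
  imports Defs
begin

text \<open>
  Up to Op2 a tuple is determined by its cyclic sums \<open>s\<^sub>i = a\<^sub>i + a\<^sub>i\<^sub>+\<^sub>1\<close>, which are subject only to the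
  vanishing of their alternating sum modulo \<open>p\<close>. On the sums, Op1 is a rotation, Op3 a reflection
  \<open>s \<mapsto> 2c - s\<close> and Op4 the braid move \<open>(x, y) \<mapsto> (y, 2y - x)\<close> of the dihedral quandle. Euclid's
  algorithm on consecutive differences turns every list of sums into a list of equal pairs
  \<open>y\<^sub>1, y\<^sub>1, y\<^sub>2, y\<^sub>2, \<dots>\<close>. Pairs commute and can be reflected in one another, and lifting one copy of
  an entry from \<open>y\<close> to \<open>y + p\<close> before running Euclid's algorithm replaces the difference of two
  pairs by its gcd with \<open>p\<close>. Hence the pairs can be brought to two values \<open>w\<close> and \<open>w + t\<close> with
  \<open>t\<close> dividing \<open>p\<close>. Here \<open>t\<close> is \<open>\<tau>\<^sub>p\<close>, shifts by even numbers reduce \<open>w\<close> to its parity, and the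
  multiplicity of \<open>w\<close> is arbitrary if \<open>p / t\<close> is odd and is measured by \<open>\<mu>\<close> otherwise.
\<close>

section \<open>Braid moves on lists of sums\<close>

definition mods :: "int \<Rightarrow> int list \<Rightarrow> int list" where
  "mods p s = map (\<lambda>x. x mod p) s"

text \<open>The move \<open>(x, y) \<mapsto> (y, 2 * y - x)\<close> keeps the difference
  \<open>y - x\<close>, so its \<open>k\<close>-th iterate adds \<open>k * (y - x)\<close> to both
  entries; allowing all integers \<open>k\<close> builds in the inverses. The entries stay integers,
  with \<open>cong\<close> identifying representatives, because Euclid's algorithm and the passage
  from \<open>y\<close> to \<open>y + p\<close> need actual integers.\<close>

inductive braid_step :: "int \<Rightarrow> int list \<Rightarrow> int list \<Rightarrow> bool" for p :: int where
  slide: "braid_step p (xs @ x # y # ys) (xs @ (x + k * (y - x)) # (y + k * (y - x)) # ys)"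
| cong: "mods p s = mods p t \<Longrightarrow> braid_step p s t"

abbreviation braid :: "int \<Rightarrow> int list \<Rightarrow> int list \<Rightarrow> bool" where
  "braid p \<equiv> (braid_step p)\<^sup>*\<^sup>*"

lemma mods_simps [simp]:
  "mods p [] = []" "mods p (x # s) = x mod p # mods p s" "mods p (s @ t) = mods p s @ mods p t"
  "length (mods p s) = length s"
  by (simp_all add: mods_def)

lemma braid_step_context: "braid_step p s t \<Longrightarrow> braid_step p (us @ s @ vs) (us @ t @ vs)"
proof (induction rule: braid_step.induct)
  case (slide xs x y ys k)
  show ?case using braid_step.slide [of p "us @ xs" x y "ys @ vs" k] by simp
next
  case (cong s t)
  then show ?case by (intro braid_step.cong) simp
qed

lemma braid_context: "braid p s t \<Longrightarrow> braid p (us @ s @ vs) (us @ t @ vs)"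
proof (induction rule: rtranclp_induct)
  case (step s t)
  from rtranclp.rtrancl_into_rtrancl [OF step.IH braid_step_context [OF step.hyps(2)]]
  show ?case .
qed simp

lemma braid_Cons: "braid p s t \<Longrightarrow> braid p (x # s) (x # t)"
  using braid_context [of p s t "[x]" "[]"] by simp

lemma braid_append: "braid p s t \<Longrightarrow> braid p (s @ vs) (t @ vs)"
  using braid_context [of p s t "[]" vs] by simp

lemma braid_cong: "mods p s = mods p t \<Longrightarrow> braid p s t"
  by (simp add: braid_step.cong r_into_rtranclp)

lemma symp_braid_step: "symp (braid_step p)"
proof (rule sympI)
  fix s t assume "braid_step p s t"
  then show "braid_step p t s"
  proof (induction rule: braid_step.induct)
    case (slide xs x y ys k)
    show ?case
      using braid_step.slide [of p xs "x + k * (y - x)" "y + k * (y - x)" ys "- k"]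
      by (simp add: algebra_simps)
  next
    case (cong s t)
    then show ?case by (simp add: braid_step.cong)
  qed
qed

lemma braid_sym: "braid p s t \<Longrightarrow> braid p t s"
  by (rule sympD [OF symp_rtranclp [OF symp_braid_step]])

lemma braid_slide:
  "x' = x + k * (y - x) \<Longrightarrow> y' = y + k * (y - x) \<Longrightarrow> braid p (x # y # ys) (x' # y' # ys)"
  using braid_step.slide [of p "[]" x y ys k] by auto

lemma braid_right: "braid p (x # y # ys) (y # (2 * y - x) # ys)"
  by (rule braid_slide [where k = 1]) auto

lemma braid_left: "braid p (x # y # ys) ((2 * x - y) # x # ys)"
  by (rule braid_slide [where k = "-1"]) auto

text \<open>Passing left over one \<open>x\<close> reflects \<open>y\<close> in \<open>x\<close>,
  and passing over the second copy reflects it back.\<close>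

lemma braid_pair_move: "braid p (x # x # y # ys) (y # x # x # ys)"
proof -
  have "braid p (x # x # y # ys) (x # (2 * x - y) # x # ys)"
    by (rule braid_Cons [OF braid_left])
  also have "braid p \<dots> (y # x # x # ys)"
    using braid_left [of p x "2 * x - y" "x # ys"] by simp
  finally show ?thesis .
qed

text \<open>Each copy of \<open>x\<close> is reflected in \<open>y\<close> as it passes to the right
  over it. The reflected pair then returns unchanged by \<open>braid_pair_move\<close>.\<close>

lemma braid_pair_reflect: "braid p (x # x # y # ys) ((2 * y - x) # (2 * y - x) # y # ys)"
proof -
  have "braid p (x # x # y # ys) (x # y # (2 * y - x) # ys)"
    by (rule braid_Cons [OF braid_right])
  also have "braid p \<dots> (y # (2 * y - x) # (2 * y - x) # ys)"
    by (rule braid_right)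
  also have "braid p \<dots> ((2 * y - x) # (2 * y - x) # y # ys)"
    by (rule braid_sym [OF braid_pair_move])
  finally show ?thesis .
qed

text \<open>Euclid's algorithm on the differences \<open>y - x\<close> and \<open>z - y\<close>.\<close>

lemma braid_euclid:
  "\<exists>u. braid p [x, y, z] [u, u, x - y + z] \<and> \<bar>x - y + z - u\<bar> = gcd (y - x) (z - y)"
proof (induction "nat \<bar>y - x\<bar>" arbitrary: x y z rule: less_induct)
  case less
  show ?case
  proof (cases "y = x")
    case True
    then show ?thesis by (intro exI [of _ x]) simp
  next
    case False
    define d where "d = y - x"
    \<comment> \<open>Chosen so that, once \<open>z\<close> has moved to the second place, the
      leading difference is \<open>(z - x) mod d\<close>, smaller than \<open>d\<close> in absolute
      value. The gcd of the two differences and the alternating sum of the triple are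
      unaffected.\<close>
    define k where "k = (z - x) div d"
    define x' y' z' where "x' = x + k * d" and "y' = z" and "z' = 2 * z - (y + k * d)"
    have "braid p [x, y, z] [x + k * d, y + k * d, z]"
      by (rule braid_slide) (auto simp: d_def)
    also have "braid p \<dots> [x', y', z']"
      unfolding x'_def y'_def z'_def by (rule braid_Cons [OF braid_right])
    finally have step: "braid p [x, y, z] [x', y', z']" .
    have small: "y' - x' = (z - x) mod d"
      by (simp add: x'_def y'_def k_def minus_div_mult_eq_mod algebra_simps flip: minus_mult_div_eq_mod)
    have "\<bar>y' - x'\<bar> < \<bar>d\<bar>"
      using False unfolding small by (simp add: d_def abs_mod_less)
    then have "nat \<bar>y' - x'\<bar> < nat \<bar>y - x\<bar>" by (simp add: d_def)
    from less [OF this, of z'] obtain u where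
      u: "braid p [x', y', z'] [u, u, x' - y' + z']"
      "\<bar>x' - y' + z' - u\<bar> = gcd (y' - x') (z' - y')" by blast
    have v: "x' - y' + z' = x - y + z" by (simp add: x'_def y'_def z'_def algebra_simps)
    have "y' - x' = (z' - y') + d" "z' - y' = (z - y) + (- k) * d"
      by (simp_all add: x'_def y'_def z'_def d_def algebra_simps)
    then have "gcd (y' - x') (z' - y') = gcd (y - x) (z - y)"
      by (metis d_def gcd.commute gcd_add1 gcd_add_mult add.commute)
    with step u v show ?thesis by (metis rtranclp_trans)
  qed
qed

section \<open>Lists of equal pairs\<close>

fun dbl :: "int list \<Rightarrow> int list" where
  "dbl [] = []"
| "dbl (y # ys) = y # y # dbl ys"

lemma dbl_append [simp]: "dbl (xs @ ys) = dbl xs @ dbl ys"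
  by (induction xs) auto

lemma length_dbl [simp]: "length (dbl ys) = 2 * length ys"
  by (induction ys) auto

lemma set_dbl [simp]: "set (dbl ys) = set ys"
  by (induction ys) auto

fun altsum :: "int list \<Rightarrow> int" where
  "altsum [] = 0"
| "altsum (x # s) = x - altsum s"

text \<open>Euclid's algorithm splits a pair off the first three entries and leaves one entry
  carrying their alternating sum, so the induction continues with a list shorter by two. For the
  last two entries the divisibility says that they agree modulo \<open>p\<close>.\<close>

lemma braid_dbl:
  assumes "even (length s)" "s \<noteq> []" "p dvd altsum s"
  shows "\<exists>ys. braid p s (dbl ys)"
  using assms
proof (induction "length s" arbitrary: s rule: less_induct)
  case less
  then obtain x y s' where s: "s = x # y # s'"
    by (cases s; cases "tl s") auto
  show ?case
  proof (cases s')
    case Nil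
    with s less.prems have "braid p s (dbl [x])"
      by (intro braid_cong) (simp add: mod_eq_dvd_iff dvd_diff_commute)
    then show ?thesis ..
  next
    case (Cons z s'')
    obtain u where "braid p [x, y, z] [u, u, x - y + z]"
      using braid_euclid by blast
    from braid_append [OF this, of s'']
    have 1: "braid p s (u # u # (x - y + z) # s'')" by (simp add: s Cons)
    have "\<exists>ys. braid p ((x - y + z) # s'') (dbl ys)"
      using less.prems by (intro less.hyps) (auto simp: s Cons algebra_simps)
    then obtain ys where "braid p ((x - y + z) # s'') (dbl ys)" ..
    from braid_context [OF this, of "[u, u]" "[]"]
    have "braid p (u # u # (x - y + z) # s'') (dbl (u # ys))" by simp
    with 1 show ?thesis by (blast intro: rtranclp_trans)
  qed
qed

text \<open>Pairs pass through everything unchanged, so only their multiset matters.\<close>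

lemma braid_dbl_perm: "mset xs = mset ys \<Longrightarrow> braid p (dbl xs) (dbl ys)"
proof (induction xs arbitrary: ys)
  case (Cons x xs)
  then have "x \<in> set ys" by (metis list.set_intros(1) set_mset_mset)
  then obtain us vs where ys: "ys = us @ x # vs" by (meson split_list)
  have move: "braid p (x # x # s @ t) (s @ x # x # t)" for s t
  proof (induction s)
    case (Cons y s)
    have "braid p (x # x # y # s @ t) (y # x # x # s @ t)" by (rule braid_pair_move)
    also have "braid p \<dots> (y # s @ x # x # t)" by (rule braid_Cons [OF Cons.IH])
    finally show ?case by simp
  qed simp
  have "mset xs = mset (us @ vs)" using Cons.prems by (simp add: ys)
  from braid_context [OF Cons.IH [OF this], of "[x, x]" "[]"]
  have "braid p (dbl (x # xs)) (x # x # dbl us @ dbl vs)" by simp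
  also have "braid p \<dots> (dbl us @ x # x # dbl vs)" by (rule move)
  finally show ?case by (simp add: ys)
qed simp

lemma braid_dbl_reflect: "braid p (dbl (x # y # ys)) (dbl ((2 * y - x) # y # ys))"
  using braid_pair_reflect by simp

text \<open>The reflections in \<open>x\<close> and in \<open>y\<close> compose to the translation
  by \<open>2 * (y - x)\<close>. The permutations only bring the required mirror next to the moving
  pair.\<close>

lemma braid_dbl_translate: "braid p (dbl (z # x # y # ys)) (dbl ((z + 2 * (y - x) * j) # x # y # ys))"
proof -
  have up: "braid p (dbl (z # x # y # ys)) (dbl ((z + 2 * (y - x)) # x # y # ys))" for z
  proof -
    have "braid p (dbl (z # x # y # ys)) (dbl ((2 * x - z) # x # y # ys))"
      by (rule braid_dbl_reflect)
    also have "braid p \<dots> (dbl ((2 * x - z) # y # x # ys))" by (rule braid_dbl_perm) simp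
    also have "braid p \<dots> (dbl ((2 * y - (2 * x - z)) # y # x # ys))" by (rule braid_dbl_reflect)
    also have "braid p \<dots> (dbl ((2 * y - (2 * x - z)) # x # y # ys))" by (rule braid_dbl_perm) simp
    finally show ?thesis by (simp add: algebra_simps)
  qed
  show ?thesis
  proof (induction j rule: int_induct [where k = 0])
    case (step1 i)
    from rtranclp_trans [OF step1(2) up] show ?case by (simp add: algebra_simps)
  next
    case (step2 i)
    have "braid p (dbl ((z + 2 * (y - x) * i) # x # y # ys))
            (dbl ((z + 2 * (y - x) * (i - 1)) # x # y # ys))"
      using braid_sym [OF up [of "z + 2 * (y - x) * (i - 1)"]] by (simp add: algebra_simps)
    with step2(2) show ?case by (rule rtranclp_trans)
  qed simp
qed

text \<open>Euclid's algorithm runs on \<open>x\<close>, \<open>y\<close>, \<open>y + p\<close>,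
  whose differences are \<open>y - x\<close> and \<open>p\<close>. It leaves the alternating sum
  \<open>x + p\<close> as third entry, which modulo \<open>p\<close> completes the spare
  \<open>x\<close> in front to a pair again.\<close>

lemma braid_dbl_gcd: "braid p (dbl (x # y # ys)) (dbl (x # (x + gcd (y - x) p) # ys))"
proof -
  obtain u where u: "braid p [x, y, y + p] [u, u, x + p]" "\<bar>x + p - u\<bar> = gcd (y - x) p"
    using braid_euclid [of p x y "y + p"] by auto
  have "braid p (dbl (x # y # ys)) (x # [x, y, y + p] @ dbl ys)"
    by (rule braid_cong) simp
  also have "braid p \<dots> (x # [u, u, x + p] @ dbl ys)"
    using braid_context [OF u(1), of "[x]" "dbl ys"] by simp
  also have "braid p \<dots> (x # u # u # x # dbl ys)"
    by (rule braid_cong) simp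
  also have "braid p \<dots> (dbl (x # u # ys))"
    using braid_Cons [OF braid_pair_move [of p u x "dbl ys"]] by simp
  also have "braid p \<dots> (dbl (x # (u - p) # ys))"
    by (rule braid_cong) (simp add: mod_simps)
  also have "braid p \<dots> (dbl (x # (x + gcd (y - x) p) # ys))"
  \<comment> \<open>The gcd is attained only up to sign; if \<open>u - p\<close> lies below
    \<open>x\<close>, reflecting it in \<open>x\<close> corrects this.\<close>
  proof (cases "u - p \<le> x")
    case True
    have "braid p (dbl (x # (u - p) # ys)) (dbl ((u - p) # x # ys))" by (rule braid_dbl_perm) simp
    also have "braid p \<dots> (dbl ((2 * x - (u - p)) # x # ys))" by (rule braid_dbl_reflect)
    also have "braid p \<dots> (dbl (x # (2 * x - (u - p)) # ys))" by (rule braid_dbl_perm) simp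
    also have "2 * x - (u - p) = x + gcd (y - x) p" using True u(2) by simp
    finally show ?thesis .
  next
    case False
    then have "u - p = x + gcd (y - x) p" using u(2) by simp
    then show ?thesis by simp
  qed
  finally show ?thesis .
qed

section \<open>Two-valued normal form\<close>

lemma mset_two_valued:
  "set us \<subseteq> {x, y} \<Longrightarrow>
    \<exists>k\<le>length us. mset us = mset (replicate k x @ replicate (length us - k) y)"
proof (induction us)
  case (Cons u us)
  then obtain k where k: "k \<le> length us"
    "mset us = mset (replicate k x @ replicate (length us - k) y)" by auto
  from Cons.prems consider "u = x" | "u = y" by auto
  then show ?case
  proof cases
    case 1
    with k show ?thesis by (intro exI [of _ "Suc k"]) simp
  next
    case 2
    with k show ?thesis by (intro exI [of _ k]) (simp add: Suc_diff_le)
  qed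
qed simp

text \<open>
  The common difference of the normal form is the least positive difference between two entries
  that any equivalent list of pairs exhibits.
\<close>

lemma braid_dbl_two_valued:
  fixes p :: int
  assumes "p \<ge> 1" and len: "length ys = m" and "m \<ge> 2"
  shows "\<exists>w t k. 1 \<le> t \<and> t dvd p \<and> 1 \<le> k \<and> k < m \<and>
    braid p (dbl ys) (dbl (replicate k w @ replicate (m - k) (w + t)))"
proof -
  let ?R = "\<lambda>zs. length zs = m \<and> braid p (dbl ys) (dbl zs)"
  define P where "P d \<longleftrightarrow> d > 0 \<and> (\<exists>x zs. ?R (x # (x + int d) # zs))" for d
  have R_trans: "?R ws" if "?R zs" "braid p (dbl zs) (dbl ws)" "length ws = length zs" for zs ws
    using that by (auto intro: rtranclp_trans)
  have R_perm: "?R ws" if "?R zs" "mset zs = mset ws" for zs ws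
    using R_trans [OF that(1) braid_dbl_perm [OF that(2)]] that(2) by (metis size_mset)
  have PI: "P (nat (y - x))" if "?R (x # y # zs)" "x < y" for x y zs
    using that unfolding P_def by (auto intro!: exI [of _ x] exI [of _ zs])
  obtain x y zs where ys: "ys = x # y # zs"
    using len \<open>m \<ge> 2\<close> by (cases ys; cases "tl ys") auto
  \<comment> \<open>A large multiple of \<open>p\<close> added to \<open>y\<close> makes the
    difference positive without any change modulo \<open>p\<close>, so the minimum below
    exists.\<close>
  have "?R (x # (y + p * (\<bar>y - x\<bar> + 1)) # zs)"
    using len by (auto simp: ys intro!: braid_cong)
  moreover have "x < y + p * (\<bar>y - x\<bar> + 1)"
  proof -
    have "x < y + 1 * (\<bar>y - x\<bar> + 1)" by simp
    also have "\<dots> \<le> y + p * (\<bar>y - x\<bar> + 1)"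
      using \<open>p \<ge> 1\<close> by (intro add_left_mono mult_right_mono) auto
    finally show ?thesis .
  qed
  ultimately have "\<exists>d. P d" using PI by blast
  define d where "d = (LEAST d. P d)"
  have "P d" unfolding d_def using \<open>\<exists>d. P d\<close> by (rule LeastI_ex)
  have min: "int d \<le> y - x" if "?R (x # y # zs)" "x < y" for x y zs
    using Least_le [of P, OF PI [OF that]] that(2) by (simp add: d_def)
  from \<open>P d\<close> obtain w zs where "d > 0" and w: "?R (w # (w + int d) # zs)"
    by (auto simp: P_def)
  \<comment> \<open>The gcd of \<open>d\<close> and \<open>p\<close> is again an exhibited
    difference, so minimality forces it to equal \<open>d\<close>; hence \<open>d\<close> divides
    \<open>p\<close>.\<close>
  have "?R (w # (w + gcd (int d) p) # zs)"
    using R_trans [OF w, of "w # (w + gcd (int d) p) # zs"] braid_dbl_gcd [of p w "w + int d" zs]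
    by simp
  then have "int d \<le> gcd (int d) p" using min [of w "w + gcd (int d) p"] \<open>d > 0\<close> by simp
  moreover have "gcd (int d) p \<le> int d" using \<open>d > 0\<close> by (simp add: zdvd_imp_le)
  ultimately have "int d dvd p" by (metis antisym gcd_dvd2)
  \<comment> \<open>The entries in \<open>us\<close> are already normalised, those in
    \<open>vs\<close> are still to be treated.\<close>
  have "\<exists>us. set us \<subseteq> {w, w + int d} \<and> ?R (w # (w + int d) # us)"
    if "?R (w # (w + int d) # us @ vs)" "set us \<subseteq> {w, w + int d}" for us vs
    using that
  proof (induction vs arbitrary: us)
    case (Cons z vs)
    \<comment> \<open>Translations by \<open>2 * d\<close> bring \<open>z\<close> into the interval
      from \<open>w\<close> to \<open>w + 2 * d\<close>, right end excluded. Minimality of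
      \<open>d\<close>, used once against \<open>w\<close> and once against \<open>w + d\<close>,
      then leaves only these two values.\<close>
    define r where "r = (z - w) mod (2 * int d)"
    define z' where "z' = w + r"
    have z': "z' = z + 2 * (w + int d - w) * (- ((z - w) div (2 * int d)))"
      unfolding z'_def r_def by (simp add: algebra_simps flip: minus_mult_div_eq_mod)
    have "?R (z # w # (w + int d) # us @ vs)"
      by (rule R_perm [OF Cons.prems(1)]) simp
    from R_trans [OF this braid_dbl_translate [where j = "- ((z - w) div (2 * int d))"]]
    have R: "?R (z' # w # (w + int d) # us @ vs)" unfolding z' by simp
    have r: "0 \<le> r" "r < 2 * int d" using \<open>d > 0\<close> by (simp_all add: r_def)
    have "\<not> (0 < r \<and> r < int d)"
      using min [OF R_perm [OF R, of "w # z' # (w + int d) # us @ vs"]] by (auto simp: z'_def)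
    moreover have "\<not> int d < r"
      using min [OF R_perm [OF R, of "(w + int d) # z' # w # us @ vs"]] r by (auto simp: z'_def)
    ultimately have "z' \<in> {w, w + int d}" using r by (auto simp: z'_def)
    then show ?case
      using Cons.IH [of "z' # us"] R_perm [OF R, of "w # (w + int d) # (z' # us) @ vs"] Cons.prems
      by simp
  qed auto
  from this [of "[]" zs] w obtain us where
    us: "set us \<subseteq> {w, w + int d}" "?R (w # (w + int d) # us)" by auto
  from mset_two_valued [OF us(1)] obtain k where k: "k \<le> length us"
    "mset us = mset (replicate k w @ replicate (length us - k) (w + int d))" by blast
  have "m = length us + 2" using us(2) by simp
  have "?R (replicate (Suc k) w @ replicate (m - Suc k) (w + int d))"
    by (rule R_perm [OF us(2)]) (use k \<open>m = length us + 2\<close> in \<open>simp add: Suc_diff_le\<close>)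
  then show ?thesis
    using \<open>int d dvd p\<close> \<open>d > 0\<close> k(1) \<open>m = length us + 2\<close>
    by (intro exI [of _ w] exI [of _ "int d"] exI [of _ "Suc k"]) auto
qed

section \<open>Braid moves as operations on tuples\<close>

lemma mods_eq_iff:
  "mods p s = mods p t \<longleftrightarrow>
    length s = length t \<and> (\<forall>i<length s. s ! i mod p = t ! i mod p)"
  by (auto simp: mods_def list_eq_iff_nth_eq)

lemma mods_rotate: "mods p (rotate i s) = rotate i (mods p s)"
  by (simp add: mods_def rotate_map)

lemma U_all_iff: "a \<in> U_all p \<longleftrightarrow> a \<noteq> [] \<and> even (length a) \<and> set a \<subseteq> {0..<p}"
  by (auto simp: U_all_def U_def)

lemma length_cyc_sums [simp]: "length (cyc_sums a) = length a"
  by (simp add: cyc_sums_def)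

lemma nth_cyc_sums: "i < length a \<Longrightarrow> cyc_sums a ! i = a ! i + a ! (Suc i mod length a)"
  by (simp add: cyc_sums_def nth_rotate1)

lemma cyc_sums_rotate1: "cyc_sums (rotate1 a) = rotate1 (cyc_sums a)"
proof (rule nth_equalityI)
  fix i assume "i < length (cyc_sums (rotate1 a))"
  moreover from this have "Suc i mod length a < length a" by (intro mod_less_divisor) auto
  ultimately show "cyc_sums (rotate1 a) ! i = rotate1 (cyc_sums a) ! i"
    by (simp add: nth_cyc_sums nth_rotate1)
qed simp

lemma cyc_sums_rotate: "cyc_sums (rotate i a) = rotate i (cyc_sums a)"
  by (induction i) (simp_all add: cyc_sums_rotate1)

definition op2 :: "int \<Rightarrow> int \<Rightarrow> int list \<Rightarrow> int list" where
  "op2 p c a = c # map (\<lambda>i. (a ! i + (- 1) ^ (i + 1) * (a ! 0 - c)) mod p) [1..<length a]"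

definition op3 :: "int \<Rightarrow> int \<Rightarrow> int list \<Rightarrow> int list" where
  "op3 p c a = c # map (\<lambda>i. (a ! 0 - a ! i + c) mod p) [1..<length a]"

lemma length_op2 [simp]: "a \<noteq> [] \<Longrightarrow> length (op2 p c a) = length a"
  by (simp add: op2_def)

lemma length_op3 [simp]: "a \<noteq> [] \<Longrightarrow> length (op3 p c a) = length a"
  by (simp add: op3_def)

lemma nth_op2:
  "i < length a \<Longrightarrow> c \<in> {0..<p} \<Longrightarrow> op2 p c a ! i = (a ! i + (- 1) ^ (i + 1) * (a ! 0 - c)) mod p"
  by (cases i) (auto simp: op2_def)

lemma nth_op3:
  "i < length a \<Longrightarrow> c \<in> {0..<p} \<Longrightarrow> op3 p c a ! i = (a ! 0 - a ! i + c) mod p"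
  by (cases i) (auto simp: op3_def)

lemma op2_U_all: "a \<in> U_all p \<Longrightarrow> c \<in> {0..<p} \<Longrightarrow> op2 p c a \<in> U_all p"
  by (auto simp: U_all_iff op2_def)

lemma op3_U_all: "a \<in> U_all p \<Longrightarrow> c \<in> {0..<p} \<Longrightarrow> op3 p c a \<in> U_all p"
  by (auto simp: U_all_iff op3_def)

lemma parity_Suc_mod: "even n \<Longrightarrow> even (Suc i mod n) = odd i" for n :: nat
  by (simp add: dvd_mod_iff)

text \<open>The corrections of cyclically adjacent entries have opposite signs and cancel in every
  sum. Across the wrap-around this relies on the even length.\<close>

lemma mods_cyc_sums_op2:
  assumes "a \<in> U_all p" "c \<in> {0..<p}"
  shows "mods p (cyc_sums (op2 p c a)) = mods p (cyc_sums a)"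
proof -
  have ne: "a \<noteq> []" "even (length a)" using assms(1) by (auto simp: U_all_iff)
  have "cyc_sums (op2 p c a) ! i mod p = cyc_sums a ! i mod p" if "i < length a" for i
  proof -
    let ?j = "Suc i mod length a"
    have "?j < length a" using ne by simp
    moreover have "(- 1) ^ (?j + 1) = - ((- 1) ^ (i + 1) :: int)"
      using parity_Suc_mod [OF ne(2), of i] by (cases "even i") auto
    ultimately show ?thesis
      using that assms(2) ne by (simp add: nth_cyc_sums nth_op2 mod_add_eq del: power_Suc)
  qed
  then show ?thesis using ne by (simp add: mods_eq_iff)
qed

lemma mods_cyc_sums_op3:
  assumes "a \<in> U_all p" "c \<in> {0..<p}"
  shows "mods p (cyc_sums (op3 p c a)) = mods p (map (\<lambda>x. 2 * (a ! 0 + c) - x) (cyc_sums a))"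
proof -
  have ne: "a \<noteq> []" using assms(1) by (auto simp: U_all_iff)
  have "cyc_sums (op3 p c a) ! i mod p = (2 * (a ! 0 + c) - cyc_sums a ! i) mod p"
    if "i < length a" for i
  proof -
    have "Suc i mod length a < length a" using ne by simp
    then have "cyc_sums (op3 p c a) ! i mod p =
        ((a ! 0 - a ! i + c) mod p + (a ! 0 - a ! (Suc i mod length a) + c) mod p) mod p"
      using that assms(2) ne by (simp add: nth_cyc_sums nth_op3)
    also have "\<dots> = (2 * (a ! 0 + c) - cyc_sums a ! i) mod p"
      unfolding mod_add_eq using that by (simp add: nth_cyc_sums algebra_simps)
    finally show ?thesis .
  qed
  then show ?thesis using ne by (simp add: mods_eq_iff)
qed

text \<open>The entry \<open>a ! 1\<close> occurs in exactly the first two sums, and these differ by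
  \<open>a ! 2 - a ! 0\<close>. Adding a multiple of that difference to the entry is therefore a
  slide on the sums.\<close>

lemma cyc_sums_op4:
  assumes "length a > 2"
  obtains x y s where "cyc_sums a = x # y # s" "y - x = a ! 2 - a ! 0"
    "mods p (cyc_sums (a[1 := (a ! 1 + k * (a ! 2 - a ! 0)) mod p])) =
       mods p ((x + k * (y - x)) # (y + k * (y - x)) # s)"
proof -
  obtain a0 a1 a2 as where a: "a = a0 # a1 # a2 # as"
    using assms by (cases a; cases "tl a"; cases "tl (tl a)") auto
  have cs: "\<exists>s. \<forall>z. cyc_sums (a0 # z # a2 # as) = (a0 + z) # (z + a2) # s"
    by (simp add: cyc_sums_def)
  then obtain s where s: "\<And>z. cyc_sums (a0 # z # a2 # as) = (a0 + z) # (z + a2) # s" by blast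
  show ?thesis
    by (rule that [of "a0 + a1" "a1 + a2" s]) (simp_all add: a s mod_simps algebra_simps)
qed

lemma op4_U_all: "a \<in> U_all p \<Longrightarrow> a[1 := z mod p] \<in> U_all p"
proof -
  assume a: "a \<in> U_all p"
  then have "p > 0" by (cases a) (auto simp: U_all_iff)
  with a show ?thesis
    by (auto simp: U_all_iff dest!: set_update_subset_insert [THEN subsetD])
qed

text \<open>The alternatives are the effects of \<open>Op1\<close>, \<open>Op2\<close>,
  \<open>Op3\<close> and \<open>Op4\<close> on the sums; the invariance proofs are case distinctions
  over them.\<close>

lemma op_step_cases:
  assumes "op_step p a b"
  shows "b \<in> U_all p \<and> length b = length a \<and>
    (cyc_sums b = rotate1 (cyc_sums a) \<or>
     mods p (cyc_sums b) = mods p (cyc_sums a) \<or>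
     (\<exists>c. mods p (cyc_sums b) = mods p (map (\<lambda>x. 2 * c - x) (cyc_sums a))) \<or>
     (\<exists>x y s. cyc_sums a = x # y # s \<and>
        mods p (cyc_sums b) = mods p (y # (2 * y - x) # s)))"
  using assms
proof cases
  case Op1
  then show ?thesis by (auto simp: cyc_sums_rotate1 U_all_iff)
next
  case (Op2 c)
  then have b: "b = op2 p c a" by (simp add: op2_def)
  have "a \<noteq> []" using Op2 by (simp add: U_all_iff)
  with op2_U_all mods_cyc_sums_op2 show ?thesis using Op2(2,3) unfolding b by simp
next
  case (Op3 c)
  then have b: "b = op3 p c a" by (simp add: op3_def)
  have "a \<noteq> []" using Op3 by (simp add: U_all_iff)
  with op3_U_all [OF Op3(2,3)] mods_cyc_sums_op3 [OF Op3(2,3)] show ?thesis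
    unfolding b by (metis length_op3)
next
  case Op4
  have b: "b = a[1 := (a ! 1 + 1 * (a ! 2 - a ! 0)) mod p]"
    using Op4 by (simp add: algebra_simps)
  obtain x y s where "cyc_sums a = x # y # s"
    "mods p (cyc_sums b) = mods p ((x + 1 * (y - x)) # (y + 1 * (y - x)) # s)"
    using cyc_sums_op4 [OF \<open>length a > 2\<close>, of p 1] unfolding b by metis
  then show ?thesis using op4_U_all [OF \<open>a \<in> U_all p\<close>] b by (auto simp: algebra_simps)
qed

section \<open>Realising moves on sums by operations on tuples\<close>

lemma op_steps_U_all: "(op_step p)\<^sup>*\<^sup>* a b \<Longrightarrow> a \<in> U_all p \<Longrightarrow> b \<in> U_all p \<and> length b = length a"
  by (induction rule: rtranclp_induct) (auto dest: op_step_cases)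

text \<open>One \<open>Op2\<close> gives \<open>a\<close> the first entry of \<open>b\<close> and
  keeps the sums modulo \<open>p\<close>. From the first entry on, the sums determine each next
  entry modulo \<open>p\<close>, hence exactly, since all entries are reduced.\<close>

lemma op_steps_same_sums:
  assumes "a \<in> U_all p" "b \<in> U_all p" "mods p (cyc_sums a) = mods p (cyc_sums b)"
  shows "(op_step p)\<^sup>*\<^sup>* a b"
proof -
  have len: "length a = length b" using arg_cong [OF assms(3), of length] by simp
  have ne: "b \<noteq> []" "set b \<subseteq> {0..<p}" "a \<noteq> []"
    using assms(1,2) by (auto simp: U_all_iff)
  have c: "b ! 0 \<in> {0..<p}" using ne nth_mem [of 0 b] by blast
  have sums: "mods p (cyc_sums (op2 p (b ! 0) a)) = mods p (cyc_sums b)"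
    using assms mods_cyc_sums_op2 [OF assms(1) c] by simp
  have "op2 p (b ! 0) a ! i = b ! i" if "i < length b" for i
    using that
  proof (induction i)
    case 0
    then show ?case by (simp add: op2_def)
  next
    case (Suc i)
    have "cyc_sums (op2 p (b ! 0) a) ! i mod p = cyc_sums b ! i mod p"
      using sums Suc.prems ne by (simp add: mods_eq_iff len)
    then have "(b ! i + op2 p (b ! 0) a ! Suc i) mod p = (b ! i + b ! Suc i) mod p"
      using Suc len ne by (simp add: nth_cyc_sums)
    then have "op2 p (b ! 0) a ! Suc i mod p = b ! Suc i mod p"
      by (simp add: mod_eq_dvd_iff)
    moreover have "b ! Suc i \<in> {0..<p}"
      using ne(2) Suc.prems nth_mem by blast
    moreover have "op2 p (b ! 0) a ! Suc i \<in> {0..<p}"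
      using op2_U_all [OF assms(1) c] Suc.prems len ne nth_mem [of "Suc i" "op2 p (b ! 0) a"]
      unfolding U_all_iff by (metis length_op2 subsetD)
    ultimately show ?case by simp
  qed
  then have "op2 p (b ! 0) a = b" using len ne by (intro nth_equalityI) auto
  moreover have "op_step p a (op2 p (b ! 0) a)"
    using Op2 [OF assms(1) c] by (simp add: op2_def)
  ultimately show ?thesis by auto
qed

lemma op_steps_rotate: "a \<in> U_all p \<Longrightarrow> (op_step p)\<^sup>*\<^sup>* a (rotate i a)"
proof (induction i)
  case (Suc i)
  have "rotate i a \<in> U_all p" using Suc.prems by (simp add: U_all_iff)
  from rtranclp.rtrancl_into_rtrancl [OF Suc.IH [OF Suc.prems] Op1 [OF this]]
  show ?case by simp
qed simp

text \<open>Iterating \<open>Op4\<close> covers nonnegative \<open>k\<close>; in general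
  \<open>k mod p\<close> iterations give the same result.\<close>

lemma op_steps_op4:
  assumes "a \<in> U_all p" "length a > 2"
  shows "(op_step p)\<^sup>*\<^sup>* a (a[1 := (a ! 1 + k * (a ! 2 - a ! 0)) mod p])"
proof -
  have "set a \<subseteq> {0..<p}" using assms by (simp add: U_all_iff)
  then have a1: "a ! 1 mod p = a ! 1" and "p > 0"
    using nth_mem [of 1 a] assms(2) by (fastforce simp: subset_iff)+
  have *: "(op_step p)\<^sup>*\<^sup>* a (a[1 := (a ! 1 + int j * (a ! 2 - a ! 0)) mod p])" for j
  proof (induction j)
    case 0
    then show ?case using a1 by simp
  next
    case (Suc j)
    let ?b = "a[1 := (a ! 1 + int j * (a ! 2 - a ! 0)) mod p]"
    have "op_step p ?b (?b[1 := (- (?b ! 0) + ?b ! 1 + ?b ! 2) mod p])"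
      using assms by (intro Op4 op4_U_all) auto
    also have "?b[1 := (- (?b ! 0) + ?b ! 1 + ?b ! 2) mod p] =
        a[1 := (a ! 1 + int (Suc j) * (a ! 2 - a ! 0)) mod p]"
    proof -
      have "(- (a ! 0) + (a ! 1 + int j * (a ! 2 - a ! 0)) mod p + a ! 2) mod p =
          ((a ! 1 + int j * (a ! 2 - a ! 0)) mod p + (a ! 2 - a ! 0)) mod p"
        by (simp add: algebra_simps)
      also have "\<dots> = (a ! 1 + int (Suc j) * (a ! 2 - a ! 0)) mod p"
        unfolding mod_add_left_eq by (simp add: algebra_simps)
      finally show ?thesis using assms(2) by simp
    qed
    finally show ?case using Suc.IH by (rule rtranclp.rtrancl_into_rtrancl [rotated])
  qed
  have "(a ! 1 + int (nat (k mod p)) * (a ! 2 - a ! 0)) mod p =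
      (a ! 1 + k * (a ! 2 - a ! 0)) mod p"
    using \<open>p > 0\<close> mod_add_cong [OF refl mod_mult_left_eq] by simp
  with * [of "nat (k mod p)"] show ?thesis by simp
qed

text \<open>Speaking about all tuples with sums \<open>s\<close> modulo \<open>p\<close> makes the
  relation reflexive and transitive without side conditions; it holds vacuously if \<open>s\<close>
  is not realised by any tuple.\<close>

definition lifts :: "int \<Rightarrow> int list \<Rightarrow> int list \<Rightarrow> bool" where
  "lifts p s t \<longleftrightarrow> (\<forall>a\<in>U_all p. mods p (cyc_sums a) = mods p s \<longrightarrow>
     (\<exists>b\<in>U_all p. mods p (cyc_sums b) = mods p t \<and> (op_step p)\<^sup>*\<^sup>* a b))"

lemma lifts_refl: "lifts p s s"
  by (auto simp: lifts_def)

lemma lifts_trans: "lifts p s t \<Longrightarrow> lifts p t u \<Longrightarrow> lifts p s u"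
  unfolding lifts_def by (meson rtranclp_trans)

text \<open>\<open>Op4\<close> acts only at the front, so a slide elsewhere is conjugated by a
  rotation.\<close>

lemma lifts_braid_step: "braid_step p s t \<Longrightarrow> lifts p s t"
proof (induction rule: braid_step.induct)
  case (cong s t)
  then show ?case by (auto simp: lifts_def)
next
  case (slide xs x y ys k)
  show ?case unfolding lifts_def
  proof (intro ballI impI)
    fix a assume a: "a \<in> U_all p" and sums: "mods p (cyc_sums a) = mods p (xs @ x # y # ys)"
    have len: "length a = length xs + 2 + length ys"
      using arg_cong [OF sums, of length] by simp
    define b where "b = rotate (length xs) a"
    have b: "b \<in> U_all p" "length b = length a" using a by (simp_all add: b_def U_all_iff)
    have "mods p (cyc_sums b) = rotate (length (mods p xs)) (mods p xs @ mods p (x # y # ys))"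
      using sums by (simp add: b_def cyc_sums_rotate mods_rotate)
    then have sums_b: "mods p (cyc_sums b) = mods p (x # y # ys @ xs)"
      by (subst (asm) rotate_append) simp
    have "\<exists>c\<in>U_all p. (op_step p)\<^sup>*\<^sup>* b c \<and>
        mods p (cyc_sums c) = mods p ((x + k * (y - x)) # (y + k * (y - x)) # ys @ xs)"
    proof (cases "length a > 2")
      case True
      then have l: "length b > 2" by (simp add: b)
      let ?c = "b[1 := (b ! 1 + k * (b ! 2 - b ! 0)) mod p]"
      obtain x' y' s where b': "cyc_sums b = x' # y' # s"
        "mods p (cyc_sums ?c) = mods p ((x' + k * (y' - x')) # (y' + k * (y' - x')) # s)"
        using cyc_sums_op4 [OF l, of p k] by metis
      have "x' mod p = x mod p" "y' mod p = y mod p" "mods p s = mods p (ys @ xs)"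
        using b'(1) sums_b by auto
      moreover from this have "(x' + k * (y' - x')) mod p = (x + k * (y - x)) mod p"
        "(y' + k * (y' - x')) mod p = (y + k * (y - x)) mod p"
        by (metis mod_add_cong mod_diff_cong mod_mult_cong)+
      ultimately have "mods p (cyc_sums ?c) =
          mods p ((x + k * (y - x)) # (y + k * (y - x)) # ys @ xs)"
        using b'(2) by simp
      then show ?thesis using op_steps_op4 [OF b(1) l] op4_U_all [OF b(1)] by blast
    next
      case False
      then have "xs = []" "ys = []" using len by auto
      from len this obtain b0 b1 where "b = [b0, b1]"
        using b(2) by (cases b; cases "tl b") auto
      then have "x mod p = y mod p"
        using sums_b by (simp add: cyc_sums_def add.commute)
      then have "(x + k * (y - x)) mod p = x mod p" "(y + k * (y - x)) mod p = y mod p"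
        by (simp_all add: mod_eq_dvd_iff dvd_diff_commute)
      then show ?thesis using sums_b b by (intro bexI [of _ b]) simp_all
    qed
    then obtain c where c: "c \<in> U_all p" "(op_step p)\<^sup>*\<^sup>* b c"
      "mods p (cyc_sums c) = mods p ((x + k * (y - x)) # (y + k * (y - x)) # ys @ xs)"
      by blast
    \<comment> \<open>Rotation goes one way only, so \<open>xs\<close> returns to the front by
      rotating all other entries past it.\<close>
    let ?l = "mods p ((x + k * (y - x)) # (y + k * (y - x)) # ys)"
    define c' where "c' = rotate (length ?l) c"
    have "mods p (cyc_sums c') = rotate (length ?l) (?l @ mods p xs)"
      unfolding c'_def using c(3) by (simp add: cyc_sums_rotate mods_rotate del: rotate_Suc)
    then have "mods p (cyc_sums c') = mods p (xs @ (x + k * (y - x)) # (y + k * (y - x)) # ys)"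
      by (subst (asm) rotate_append) simp
    moreover have "c' \<in> U_all p" using c(1) by (simp add: c'_def U_all_iff)
    moreover have "(op_step p)\<^sup>*\<^sup>* a c'"
      using op_steps_rotate [OF a, of "length xs"] c(2) op_steps_rotate [OF c(1), of "length ?l"]
      unfolding b_def c'_def by (meson rtranclp_trans)
    ultimately show "\<exists>b\<in>U_all p. mods p (cyc_sums b) =
        mods p (xs @ (x + k * (y - x)) # (y + k * (y - x)) # ys) \<and> (op_step p)\<^sup>*\<^sup>* a b" by blast
  qed
qed

lemma lifts_braid: "braid p s t \<Longrightarrow> lifts p s t"
  by (induction rule: rtranclp_induct) (auto intro: lifts_refl lifts_trans lifts_braid_step)

lemma lifts_reflect: "lifts p s (map (\<lambda>x. 2 * c - x) s)"
  unfolding lifts_def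
proof (intro ballI impI)
  fix a assume a: "a \<in> U_all p" and sums: "mods p (cyc_sums a) = mods p s"
  have "p > 0" using a by (cases a) (auto simp: U_all_iff)
  \<comment> \<open>\<open>Op3\<close> with parameter \<open>c'\<close> reflects the sums by
    \<open>2 * (a ! 0 + c') - x\<close>; this choice turns the constant into \<open>2 * c\<close>
    modulo \<open>p\<close>.\<close>
  define c' where "c' = (c - a ! 0) mod p"
  have c': "c' \<in> {0..<p}" using \<open>p > 0\<close> by (simp add: c'_def)
  have "(2 * (a ! 0 + c') - x) mod p = (2 * c - y) mod p" if "x mod p = y mod p" for x y
  proof -
    have "(2 * (a ! 0 + c') - x) mod p = (2 * (a ! 0 + (c - a ! 0)) - x) mod p"
      unfolding c'_def mod_eq_dvd_iff by (simp flip: minus_div_mult_eq_mod)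
    also have "\<dots> = (2 * c - y) mod p" using mod_diff_cong [OF refl that, of "2 * c"] by simp
    finally show ?thesis .
  qed
  then have "mods p (cyc_sums (op3 p c' a)) = mods p (map (\<lambda>x. 2 * c - x) s)"
    using sums unfolding mods_cyc_sums_op3 [OF a c'] by (simp add: mods_eq_iff)
  moreover have "op_step p a (op3 p c' a)" using Op3 [OF a c'] by (simp add: op3_def)
  ultimately show "\<exists>b\<in>U_all p. mods p (cyc_sums b) = mods p (map (\<lambda>x. 2 * c - x) s) \<and>
      (op_step p)\<^sup>*\<^sup>* a b"
    using op3_U_all [OF a c'] by blast
qed

text \<open>Reflecting in \<open>0\<close> and then in \<open>c\<close> is the translation by
  \<open>2 * c\<close>.\<close>

lemma lifts_shift: "lifts p s (map (\<lambda>x. x + 2 * c) s)"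
  using lifts_trans [OF lifts_reflect [of p s 0] lifts_reflect [of p _ c]]
  by (simp add: o_def algebra_simps)

section \<open>Invariants\<close>

definition cong_all :: "int \<Rightarrow> int list \<Rightarrow> bool" where
  "cong_all k s \<longleftrightarrow> (\<forall>x\<in>set s. \<forall>y\<in>set s. [x = y] (mod k))"

definition cong_to :: "int \<Rightarrow> int \<Rightarrow> int list \<Rightarrow> bool" where
  "cong_to k r s \<longleftrightarrow> (\<forall>x\<in>set s. [x = r] (mod k))"

text \<open>A common form of both signed counts: \<open>t = 1\<close> and \<open>c = 0\<close> give
  \<open>mu\<close>, while \<open>t\<close> equal to \<open>tau p a\<close> and \<open>c\<close>
  equal to the first sum give the number whose absolute value is \<open>mu_tau\<close> (see
  \<open>mu_reduced\<close>).\<close>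

definition parity_diff :: "int \<Rightarrow> int \<Rightarrow> int list \<Rightarrow> int" where
  "parity_diff t c s = (\<Sum>x\<leftarrow>s. if even ((x - c) div t) then 1 else - 1)"

lemma parity_diff_simps [simp]:
  "parity_diff t c [] = 0"
  "parity_diff t c (x # s) = (if even ((x - c) div t) then 1 else - 1) + parity_diff t c s"
  "parity_diff t c (s @ u) = parity_diff t c s + parity_diff t c u"
  by (simp_all add: parity_diff_def)

lemma parity_diff_dbl [simp]: "parity_diff t c (dbl ys) = 2 * parity_diff t c ys"
  by (induction ys) auto

lemma parity_diff_replicate [simp]:
  "parity_diff t c (replicate k x) = (if even ((x - c) div t) then int k else - int k)"
  by (induction k) auto

lemma cong_mod_iff: "k dvd p \<Longrightarrow> [x mod p = r] (mod k) \<longleftrightarrow> [x = r] (mod k)" for x :: int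
  by (simp add: cong_def mod_mod_cancel)

lemma cong_all_mods:
  assumes "k dvd p"
  shows "cong_all k (mods p s) \<longleftrightarrow> cong_all k s"
  by (simp add: cong_all_def mods_def cong_mod_iff [OF assms]
      cong_sym_eq [of _ "_ mod p"])

lemma cong_to_mods:
  assumes "k dvd p"
  shows "cong_to k r (mods p s) \<longleftrightarrow> cong_to k r s"
  by (simp add: cong_to_def mods_def cong_mod_iff [OF assms])

lemma cong_all_reflect: "cong_all k (map (\<lambda>x. 2 * c - x) s) \<longleftrightarrow> cong_all k s"
  by (auto simp: cong_all_def cong_iff_dvd_diff dvd_diff_commute)

lemma cong_all_iff_cong_to:
  assumes "y \<in> set s"
  shows "cong_all k s \<longleftrightarrow> cong_to k y s"
proof
  assume *: "cong_to k y s"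
  show "cong_all k s" unfolding cong_all_def
  proof (intro ballI)
    fix u v assume "u \<in> set s" "v \<in> set s"
    with * have "[u = y] (mod k)" "[v = y] (mod k)" by (auto simp: cong_to_def)
    then show "[u = v] (mod k)" using cong_trans cong_sym by blast
  qed
qed (use assms in \<open>simp add: cong_all_def cong_to_def\<close>)

text \<open>Both lists contain \<open>y\<close>, so it is enough to compare with \<open>y\<close>,
  and \<open>2 * y - x\<close> is congruent to \<open>y\<close> exactly when \<open>x\<close>
  is.\<close>

lemma cong_all_swap: "cong_all k (y # (2 * y - x) # s) \<longleftrightarrow> cong_all k (x # y # s)"
proof -
  have "cong_to k y (y # (2 * y - x) # s) \<longleftrightarrow> cong_to k y (x # y # s)"
    by (simp add: cong_to_def cong_iff_dvd_diff dvd_diff_commute)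
  then show ?thesis by (simp add: cong_all_iff_cong_to [of y])
qed

lemma op_step_cong_all:
  assumes "op_step p a b" "k dvd p"
  shows "cong_all k (cyc_sums b) \<longleftrightarrow> cong_all k (cyc_sums a)"
proof -
  consider "cyc_sums b = rotate1 (cyc_sums a)"
    | "mods p (cyc_sums b) = mods p (cyc_sums a)"
    | c where "mods p (cyc_sums b) = mods p (map (\<lambda>x. 2 * c - x) (cyc_sums a))"
    | x y s where "cyc_sums a = x # y # s" "mods p (cyc_sums b) = mods p (y # (2 * y - x) # s)"
    using op_step_cases [OF assms(1)] by blast
  then show ?thesis
  proof cases
    case 1
    then show ?thesis by (simp add: cong_all_def)
  next
    case 2
    then show ?thesis by (metis cong_all_mods assms(2))
  next
    case (3 c)
    then show ?thesis by (metis cong_all_mods assms(2) cong_all_reflect)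
  next
    case (4 x y s)
    then show ?thesis by (metis cong_all_mods assms(2) cong_all_swap)
  qed
qed

lemma op_step_cong_to:
  assumes "op_step p a b" "even p"
  shows "cong_to 2 r (cyc_sums b) \<longleftrightarrow> cong_to 2 r (cyc_sums a)"
proof -
  have reflect: "[2 * c - x = r] (mod 2) \<longleftrightarrow> [x = r] (mod 2)" for c x :: int
    unfolding cong_def by presburger
  consider "cyc_sums b = rotate1 (cyc_sums a)"
    | "mods p (cyc_sums b) = mods p (cyc_sums a)"
    | c where "mods p (cyc_sums b) = mods p (map (\<lambda>x. 2 * c - x) (cyc_sums a))"
    | x y s where "cyc_sums a = x # y # s" "mods p (cyc_sums b) = mods p (y # (2 * y - x) # s)"
    using op_step_cases [OF assms(1)] by blast
  then show ?thesis
  proof cases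
    case 1
    then show ?thesis by (simp add: cong_to_def)
  next
    case 2
    then show ?thesis by (metis cong_to_mods assms(2))
  next
    case (3 c)
    then have "cong_to 2 r (cyc_sums b) \<longleftrightarrow> cong_to 2 r (map (\<lambda>x. 2 * c - x) (cyc_sums a))"
      by (metis cong_to_mods assms(2))
    then show ?thesis by (simp add: cong_to_def reflect)
  next
    case (4 x y s)
    then have "cong_to 2 r (cyc_sums b) \<longleftrightarrow> cong_to 2 r (y # (2 * y - x) # s)"
      by (metis cong_to_mods assms(2))
    then show ?thesis by (auto simp: cong_to_def reflect 4)
  qed
qed

section \<open>Behaviour of the signed count under the moves\<close>

lemma parity_div_add:
  fixes x :: int
  assumes "t \<noteq> 0" "t dvd z"
  shows "even ((x + 2 * z) div t) \<longleftrightarrow> even (x div t)"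
proof -
  obtain q where "z = t * q" using assms(2) ..
  then have "(x + 2 * z) div t = 2 * q + x div t"
    using assms(1) div_mult_self2 [of t x "2 * q"] by (simp add: mult.left_commute)
  then show ?thesis by simp
qed

text \<open>Reduction modulo \<open>p\<close> shifts an entry by a multiple of \<open>2 * t\<close>,
  hence its quotient by an even number. This is where the evenness of \<open>p div t\<close> enters
  the classification.\<close>

lemma parity_diff_mods:
  assumes "t \<noteq> 0" "2 * t dvd p"
  shows "parity_diff t c (mods p s) = parity_diff t c s"
proof (induction s)
  case (Cons x s)
  obtain q where q: "p = 2 * t * q" using assms(2) ..
  have "x mod p - c = (x - c) + 2 * (t * (- q * (x div p)))"
    using minus_mult_div_eq_mod [of x p] arg_cong [OF q, of "\<lambda>z. z * (x div p)"]
    by (simp add: mult.assoc)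
  then have "even ((x mod p - c) div t) \<longleftrightarrow> even ((x - c) div t)"
    using parity_div_add [OF assms(1)] by (metis dvd_triv_left)
  with Cons show ?case by simp
qed simp

text \<open>\<open>2 * y - x\<close> exceeds \<open>x\<close> by \<open>2 * (y - x)\<close>, an even
  multiple of \<open>t\<close>.\<close>

lemma parity_diff_swap:
  assumes "t \<noteq> 0" "t dvd y - x"
  shows "parity_diff t c (y # (2 * y - x) # s) = parity_diff t c (x # y # s)"
  using parity_div_add [OF assms, of "x - c"] by (simp add: algebra_simps)

text \<open>With the base point reflected as well, every quotient just changes its sign.\<close>

lemma parity_diff_reflect:
  assumes "t \<noteq> 0" "\<forall>x\<in>set s. t dvd x - c"
  shows "parity_diff t (2 * e - c) (map (\<lambda>x. 2 * e - x) s) = parity_diff t c s"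
  using assms(2)
proof (induction s)
  case (Cons x s)
  have "2 * e - x - (2 * e - c) = - (x - c)" by simp
  then have "(2 * e - x - (2 * e - c)) div t = - ((x - c) div t)"
    using Cons.prems by (simp only: dvd_neg_div list.set_intros)
  with Cons show ?case by simp
qed simp

text \<open>Moving the base point by an odd multiple of \<open>t\<close> flips all signs at once, by
  an even multiple none. Hence the absolute value in \<open>mu_tau\<close>.\<close>

lemma parity_diff_base:
  assumes "t \<noteq> 0" "t dvd c - c'" "\<forall>x\<in>set s. t dvd x - c"
  shows "\<bar>parity_diff t c' s\<bar> = \<bar>parity_diff t c s\<bar>"
proof -
  have "parity_diff t c' s = (if even ((c - c') div t) then 1 else - 1) * parity_diff t c s"
    using assms(3)
  proof (induction s)
    case (Cons x s)
    have "(x - c') div t = (x - c) div t + (c - c') div t"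
      using div_plus_div_distrib_dvd_right [OF assms(2), of "x - c"] by simp
    with Cons show ?case by simp
  qed simp
  then show ?thesis by simp
qed

lemma mu_eq_parity_diff: "mu a = parity_diff 1 0 (cyc_sums a)"
proof -
  have "int (length (filter even s)) - int (length (filter odd s)) = parity_diff 1 0 s" for s
    by (induction s) auto
  then show ?thesis by (simp add: mu_def)
qed

lemma cong_allD: "cong_all k s \<Longrightarrow> i < length s \<Longrightarrow> j < length s \<Longrightarrow> k dvd s ! i - s ! j"
  by (simp add: cong_all_def cong_iff_dvd_diff)

text \<open>Consecutive sums differ by entries two places apart. The lemma makes the divisions in
  \<open>reduced\<close> exact.\<close>

lemma dvd_diff_parity_entry:
  assumes "even (length a)" "cong_all t (cyc_sums a)" "i < length a"
  shows "t dvd a ! i - a ! (i mod 2)"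
  using assms(3)
proof (induction i rule: less_induct)
  case (less i)
  show ?case
  proof (cases "i < 2")
    case False
    define k where "k = i - 2"
    have k: "i = Suc (Suc k)" "i mod 2 = k mod 2" using False by (auto simp: k_def mod_if)
    have "t dvd cyc_sums a ! Suc k - cyc_sums a ! k"
      using less.prems assms(2) by (intro cong_allD) (auto simp: k)
    moreover have "cyc_sums a ! Suc k - cyc_sums a ! k = a ! i - a ! k"
      using less.prems by (simp add: nth_cyc_sums k)
    moreover have "t dvd a ! k - a ! (k mod 2)" using less by (simp add: k)
    ultimately have "t dvd (a ! i - a ! k) + (a ! k - a ! (k mod 2))" by (metis dvd_add)
    then show ?thesis by (simp add: k)
  qed (simp add: less.prems)
qed

text \<open>Adjacent positions have different parities, so the two subtracted entries are always
  \<open>a ! 0\<close> and \<open>a ! 1\<close>, whose sum is the first cyclic sum. Reducing modulo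
  the even number \<open>p div t\<close> keeps parities.\<close>

lemma mu_reduced:
  assumes "even (length a)" "a \<noteq> []" "cong_all t (cyc_sums a)" "t \<noteq> 0" "even (p div t)"
  shows "mu (reduced p t a) = parity_diff t (cyc_sums a ! 0) (cyc_sums a)"
proof -
  let ?n = "length a" and ?r = "reduced p t a"
  have len: "length ?r = ?n" by (simp add: reduced_def)
  have n: "?n \<ge> 2" using assms(1,2) by (cases a; cases "tl a") auto
  have "even (cyc_sums ?r ! i) \<longleftrightarrow> even ((cyc_sums a ! i - cyc_sums a ! 0) div t)"
    if i: "i < ?n" for i
  proof -
    let ?j = "Suc i mod ?n" and ?q = "\<lambda>i. (a ! i - a ! (i mod 2)) div t"
    have j: "?j < ?n" using assms(2) by (intro mod_less_divisor) simp
    have r: "even (?r ! i) \<longleftrightarrow> even (?q i)" if "i < ?n" for i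
      using that assms(5) by (simp add: reduced_def dvd_mod_iff)
    have "even (cyc_sums ?r ! i) \<longleftrightarrow> even (?q i + ?q ?j)"
      using r [OF i] r [OF j] i by (simp add: nth_cyc_sums len)
    also have "?q i + ?q ?j = ((a ! i - a ! (i mod 2)) + (a ! ?j - a ! (?j mod 2))) div t"
      using dvd_diff_parity_entry [OF assms(1,3) i] by (simp add: div_plus_div_distrib_dvd_left)
    also have "(a ! i - a ! (i mod 2)) + (a ! ?j - a ! (?j mod 2)) =
        cyc_sums a ! i - cyc_sums a ! 0"
    proof -
      have "?j mod 2 = Suc i mod 2" using assms(1) by (rule mod_mod_cancel)
      moreover have "i mod 2 = 0 \<and> Suc i mod 2 = 1 \<or> i mod 2 = 1 \<and> Suc i mod 2 = 0"
        by presburger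
      ultimately have "a ! (i mod 2) + a ! (?j mod 2) = a ! 0 + a ! 1" by auto
      moreover have "cyc_sums a ! 0 = a ! 0 + a ! 1" "cyc_sums a ! i = a ! i + a ! ?j"
        using i n nth_cyc_sums [of 0 a] nth_cyc_sums [of i a] assms(2) by simp_all
      ultimately show ?thesis by simp
    qed
    finally show ?thesis .
  qed
  then have "map (\<lambda>x. if even ((x - 0) div 1) then 1 else - 1) (cyc_sums ?r) =
      map (\<lambda>x. if even ((x - cyc_sums a ! 0) div t) then 1 else - 1 :: int) (cyc_sums a)"
    by (intro nth_equalityI) (auto simp: len)
  then show ?thesis unfolding mu_eq_parity_diff parity_diff_def by metis
qed

section \<open>Invariance under the operations\<close>

lemma tau_def': "tau p a = Max {k \<in> {1..p}. k dvd p \<and> cong_all k (cyc_sums a)}"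
  by (simp add: tau_def cong_all_def)

lemma eps_def': "eps a = (if cong_to 2 0 (cyc_sums a) then 0
    else if cong_to 2 1 (cyc_sums a) then 1 else \<infinity>)"
  by (simp add: eps_def cong_to_def)

lemma cong_all_tau:
  assumes "p \<ge> 1"
  shows "cong_all (tau p a) (cyc_sums a)"
proof -
  have "tau p a \<in> {k \<in> {1..p}. k dvd p \<and> cong_all k (cyc_sums a)}"
    unfolding tau_def'
  proof (rule Max_in)
    have "1 \<in> {k \<in> {1..p}. k dvd p \<and> cong_all k (cyc_sums a)}"
      using assms by (simp add: cong_all_def cong_iff_dvd_diff)
    then show "{k \<in> {1..p}. k dvd p \<and> cong_all k (cyc_sums a)} \<noteq> {}" by blast
    show "finite {k \<in> {1..p}. k dvd p \<and> cong_all k (cyc_sums a)}"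
      by (rule finite_subset [of _ "{1..p}"]) auto
  qed
  then show ?thesis by simp
qed

lemma op_step_tau: "op_step p a b \<Longrightarrow> tau p b = tau p a"
  by (simp add: tau_def' op_step_cong_all cong: conj_cong)

lemma op_step_eps: "op_step p a b \<Longrightarrow> even p \<Longrightarrow> eps b = eps a"
  by (simp add: eps_def' op_step_cong_to)

text \<open>\<open>Op3\<close> moves the base point to its mirror image \<open>2 * d - c\<close>,
  the other operations keep it. Its parity survives, which for \<open>t = 1\<close> allows a return
  to base point \<open>0\<close> in \<open>op_step_mu\<close>.\<close>

lemma op_step_parity_diff:
  assumes "op_step p a b" "t \<noteq> 0" "2 * t dvd p" "\<forall>x\<in>set (cyc_sums a). t dvd x - c"
  shows "\<exists>e. [e = c] (mod 2) \<and>
    (\<forall>x\<in>set (cyc_sums b). t dvd x - e) \<and>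
    parity_diff t e (cyc_sums b) = parity_diff t c (cyc_sums a)"
proof -
  have tp: "t dvd p" using assms(3) by (rule dvd_mult_right)
  have dvd: "\<forall>x\<in>set s. t dvd x - e" if "mods p s = mods p u" "\<forall>x\<in>set u. t dvd x - e" for s u e
    using that cong_to_mods [OF tp, of e] unfolding cong_to_def cong_iff_dvd_diff by metis
  have pd: "parity_diff t e s = parity_diff t e u" if "mods p s = mods p u" for s u e
    using that parity_diff_mods [OF assms(2,3)] by metis
  consider "cyc_sums b = rotate1 (cyc_sums a)"
    | "mods p (cyc_sums b) = mods p (cyc_sums a)"
    | d where "mods p (cyc_sums b) = mods p (map (\<lambda>x. 2 * d - x) (cyc_sums a))"
    | x y s where "cyc_sums a = x # y # s" "mods p (cyc_sums b) = mods p (y # (2 * y - x) # s)"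
    using op_step_cases [OF assms(1)] by blast
  then show ?thesis
  proof cases
    case 1
    have "parity_diff t c (rotate1 s) = parity_diff t c s" for s by (cases s) auto
    then show ?thesis using assms(4) 1 by (intro exI [of _ c]) simp
  next
    case 2
    from dvd [OF this assms(4)] pd [OF this] show ?thesis by (intro exI [of _ c]) simp
  next
    case (3 d)
    have "\<forall>x\<in>set (map (\<lambda>x. 2 * d - x) (cyc_sums a)). t dvd x - (2 * d - c)"
      using assms(4) by (auto simp: dvd_diff_commute)
    from dvd [OF 3 this] pd [OF 3] parity_diff_reflect [OF assms(2,4)]
    show ?thesis by (intro exI [of _ "2 * d - c"]) (simp add: cong_iff_dvd_diff)
  next
    case (4 x y s)
    have xy: "t dvd x - c" "t dvd y - c" using assms(4) 4 by auto
    then have "t dvd y - x" using dvd_diff [of t "y - c" "x - c"] by simp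
    moreover have "2 * y - x - c = (y - c) + (y - x)" by simp
    ultimately have "t dvd 2 * y - x - c" using xy by (metis dvd_add)
    then have "\<forall>x\<in>set (y # (2 * y - x) # s). t dvd x - c" using xy assms(4) 4 by auto
    from dvd [OF 4(2) this] pd [OF 4(2)] parity_diff_swap [OF assms(2) \<open>t dvd y - x\<close>]
    show ?thesis unfolding 4(1) by (intro exI [of _ c]) simp
  qed
qed

lemma op_step_mu:
  assumes "op_step p a b" "even p"
  shows "mu b = mu a"
proof -
  obtain e where e: "[e = 0] (mod 2)" "parity_diff 1 e (cyc_sums b) = mu a"
    using op_step_parity_diff [OF assms(1), of 1 0] assms(2) by (auto simp: mu_eq_parity_diff)
  have "parity_diff 1 e s = parity_diff 1 0 s" for s
    using e(1) by (induction s) (auto simp: cong_iff_dvd_diff)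
  with e(2) show ?thesis by (metis mu_eq_parity_diff)
qed

lemma op_step_mu_tau:
  assumes "op_step p a b" "t \<ge> 1" "2 * t dvd p" "p \<ge> 1"
  shows "mu_tau p t b = mu_tau p t a"
proof (cases "tau p a = t")
  case True
  have U: "a \<in> U_all p" using assms(1) by cases auto
  then have a: "a \<noteq> []" "even (length a)" by (auto simp: U_all_iff)
  have b: "b \<noteq> []" "even (length b)" using op_step_cases [OF assms(1)] by (auto simp: U_all_iff)
  have ca: "cong_all t (cyc_sums a)" and cb: "cong_all t (cyc_sums b)"
    using cong_all_tau [OF assms(4)] op_step_tau [OF assms(1)] True by metis+
  have even: "even (p div t)" using assms(2,3) by auto
  have sa: "\<forall>x\<in>set (cyc_sums a). t dvd x - cyc_sums a ! 0"
    using ca a nth_mem [of 0 "cyc_sums a"] by (simp add: cong_all_def cong_iff_dvd_diff)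
  obtain e where e: "\<forall>x\<in>set (cyc_sums b). t dvd x - e"
    "parity_diff t e (cyc_sums b) = parity_diff t (cyc_sums a ! 0) (cyc_sums a)"
    using op_step_parity_diff [OF assms(1) _ assms(3) sa] assms(2) by auto
  \<comment> \<open>\<open>e\<close> need not be the first sum of \<open>b\<close>, but the two base
    points differ by a multiple of \<open>t\<close>, which the absolute value absorbs.\<close>
  have "t dvd cyc_sums b ! 0 - e" using e(1) b by simp
  then have "\<bar>parity_diff t (cyc_sums b ! 0) (cyc_sums b)\<bar> = \<bar>parity_diff t e (cyc_sums b)\<bar>"
    using e(1) assms(2) by (intro parity_diff_base) (auto simp: dvd_diff_commute)
  then have "\<bar>mu (reduced p t b)\<bar> = \<bar>mu (reduced p t a)\<bar>"
    using mu_reduced [OF a(2,1) ca _ even] mu_reduced [OF b(2,1) cb _ even] e(2) assms(2) by simp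
  then show ?thesis by (simp add: mu_tau_def op_step_tau [OF assms(1)])
qed (simp add: mu_tau_def op_step_tau [OF assms(1)])

lemma op_steps_tau: "(op_step p)\<^sup>*\<^sup>* a b \<Longrightarrow> tau p b = tau p a"
  by (induction rule: rtranclp_induct) (simp_all add: op_step_tau)

lemma op_steps_eps: "(op_step p)\<^sup>*\<^sup>* a b \<Longrightarrow> even p \<Longrightarrow> eps b = eps a"
  by (induction rule: rtranclp_induct) (simp_all add: op_step_eps)

lemma op_steps_mu: "(op_step p)\<^sup>*\<^sup>* a b \<Longrightarrow> even p \<Longrightarrow> mu b = mu a"
  by (induction rule: rtranclp_induct) (simp_all add: op_step_mu)

lemma op_steps_mu_tau:
  "(op_step p)\<^sup>*\<^sup>* a b \<Longrightarrow> t \<ge> 1 \<Longrightarrow> 2 * t dvd p \<Longrightarrow> p \<ge> 1 \<Longrightarrow> mu_tau p t b = mu_tau p t a"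
  by (induction rule: rtranclp_induct) (simp_all add: op_step_mu_tau)

section \<open>Invariants of two-valued lists\<close>

definition two_valued :: "nat \<Rightarrow> nat \<Rightarrow> int \<Rightarrow> int \<Rightarrow> int list" where
  "two_valued m k w t = dbl (replicate k w @ replicate (m - k) (w + t))"

text \<open>The list is constant modulo a divisor \<open>l\<close> of \<open>p\<close> exactly when
  \<open>l\<close> divides the difference \<open>t\<close> of its two values. For
  \<open>t = p\<close> the two values agree modulo \<open>p\<close>, which is how constant lists are
  covered.\<close>

lemma tau_two_valued:
  assumes "mods p (cyc_sums a) = mods p (two_valued m k w t)"
    and "1 \<le> t" "t dvd p" "1 \<le> k" "k < m \<or> t = p" "p \<ge> 1"
  shows "tau p a = t"
proof -
  have "cong_all l (cyc_sums a) \<longleftrightarrow> l dvd t" if "l dvd p" for l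
  proof -
    have "cong_all l (cyc_sums a) \<longleftrightarrow> cong_all l (two_valued m k w t)"
      using cong_all_mods [OF that] assms(1) by metis
    also have "\<dots> \<longleftrightarrow> (k < m \<longrightarrow> l dvd t)"
      using assms(4) by (auto simp: two_valued_def cong_all_def cong_iff_dvd_diff)
    finally show ?thesis using assms(5) that by auto
  qed
  then have "tau p a = Max {l \<in> {1..p}. l dvd p \<and> l dvd t}"
    unfolding tau_def' by (intro arg_cong [of _ _ Max]) auto
  also have "\<dots> = t"
    using assms by (intro Max_eqI) (auto simp: zdvd_imp_le)
  finally show ?thesis .
qed

text \<open>There are \<open>2 * k\<close> even sums and \<open>2 * (m - k)\<close> odd
  ones.\<close>

lemma mu_two_valued:
  assumes "mods p (cyc_sums a) = mods p (two_valued m k w t)"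
    and "even p" "even w" "odd t" "k \<le> m"
  shows "mu a = 4 * int k - 2 * int m"
proof -
  have "mu a = parity_diff 1 0 (two_valued m k w t)"
    using assms(1,2) parity_diff_mods [of 1 p 0] by (metis mu_eq_parity_diff mult.right_neutral one_neq_zero)
  then show ?thesis using assms(3-) by (simp add: two_valued_def of_nat_diff)
qed

lemma eps_two_valued:
  assumes "mods p (cyc_sums a) = mods p (two_valued m k w t)"
    and "even p" "even t" "1 \<le> k"
  shows "eps a = (if even w then 0 else 1)"
proof -
  have *: "cong_to 2 r (cyc_sums a) \<longleftrightarrow> [w = r] (mod 2)" for r
  proof -
    have "cong_to 2 r (cyc_sums a) \<longleftrightarrow> cong_to 2 r (two_valued m k w t)"
      using cong_to_mods [OF assms(2)] assms(1) by metis
    also have "\<dots> \<longleftrightarrow> [w = r] (mod 2)"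
      using assms(3,4) by (auto simp: two_valued_def cong_to_def cong_iff_dvd_diff)
    finally show ?thesis .
  qed
  show ?thesis unfolding eps_def' * by (simp add: cong_iff_dvd_diff)
qed

text \<open>With base point \<open>w\<close> the quotients are \<open>0\<close> and
  \<open>1\<close>, so the count is that of \<open>mu_two_valued\<close>. Passing to the first sum
  as base point costs at most a sign.\<close>

lemma mu_tau_two_valued:
  assumes "mods p (cyc_sums a) = mods p (two_valued m k w t)" "a \<in> U_all p"
    and "1 \<le> t" "2 * t dvd p" "1 \<le> k" "k < m" "p \<ge> 1"
  shows "mu_tau p t a = enat (nat \<bar>4 * int k - 2 * int m\<bar>)"
proof -
  have a: "a \<noteq> []" "even (length a)" using assms(2) by (auto simp: U_all_iff)
  have tp: "t dvd p" using assms(4) by (rule dvd_mult_right)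
  have even: "even (p div t)" using assms(3,4) by auto
  have tau: "tau p a = t" using tau_two_valued [OF assms(1)] assms tp by blast
  have ca: "cong_all t (cyc_sums a)" using cong_all_tau [OF assms(7)] tau by metis
  have t: "t \<noteq> 0" using assms(3) by simp
  have "cong_to t w (cyc_sums a)"
  proof -
    have "cong_to t w (two_valued m k w t)"
      by (auto simp: two_valued_def cong_to_def cong_iff_dvd_diff)
    then show ?thesis using cong_to_mods [OF tp, of w] assms(1) by metis
  qed
  then have w: "\<forall>x\<in>set (cyc_sums a). t dvd x - w" by (simp add: cong_to_def cong_iff_dvd_diff)
  then have "t dvd cyc_sums a ! 0 - w" using a by simp
  then have "\<bar>parity_diff t (cyc_sums a ! 0) (cyc_sums a)\<bar> = \<bar>parity_diff t w (cyc_sums a)\<bar>"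
    using w t by (intro parity_diff_base) (auto simp: dvd_diff_commute)
  also have "parity_diff t w (cyc_sums a) = parity_diff t w (two_valued m k w t)"
    using parity_diff_mods [OF t assms(4)] assms(1) by metis
  also have "\<dots> = 4 * int k - 2 * int m"
    using t assms(6) by (simp add: two_valued_def of_nat_diff)
  finally show ?thesis using mu_reduced [OF a(2,1) ca t even] tau by (simp add: mu_tau_def)
qed

section \<open>Normal forms of tuples\<close>

text \<open>Both directions are demanded because \<open>lifts\<close>, being vacuous on lists that
  no tuple realises, is not symmetric by its form.\<close>

definition lift_equiv :: "int \<Rightarrow> int list \<Rightarrow> int list \<Rightarrow> bool" where
  "lift_equiv p s t \<longleftrightarrow> lifts p s t \<and> lifts p t s"

lemma lift_equiv_sym: "lift_equiv p s t \<Longrightarrow> lift_equiv p t s"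
  by (simp add: lift_equiv_def)

lemma lift_equiv_trans [trans]: "lift_equiv p s t \<Longrightarrow> lift_equiv p t u \<Longrightarrow> lift_equiv p s u"
  unfolding lift_equiv_def by (meson lifts_trans)

lemma lift_equiv_braid: "braid p s t \<Longrightarrow> lift_equiv p s t"
  by (simp add: lift_equiv_def lifts_braid braid_sym)

lemma lift_equiv_cong: "mods p s = mods p t \<Longrightarrow> lift_equiv p s t"
  by (intro lift_equiv_braid braid_cong)

lemma lift_equiv_shift: "lift_equiv p s (map (\<lambda>x. x + 2 * c) s)"
  using lifts_shift [of p s c] lifts_shift [of p "map (\<lambda>x. x + 2 * c) s" "- c"]
  by (simp add: lift_equiv_def o_def)

lemma lift_equivE:
  assumes "lift_equiv p (cyc_sums a) s" "a \<in> U_all p"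
  obtains b where "b \<in> U_all p" "mods p (cyc_sums b) = mods p s" "(op_step p)\<^sup>*\<^sup>* a b"
  using assms unfolding lift_equiv_def lifts_def by blast

lemma op_steps_lift_equiv:
  assumes "a \<in> U_all p" "b \<in> U_all p"
    and "lift_equiv p (cyc_sums a) s" "lift_equiv p (cyc_sums b) s"
  shows "(op_step p)\<^sup>*\<^sup>* a b"
proof -
  have "lift_equiv p (cyc_sums a) (cyc_sums b)"
    using assms(3,4) lift_equiv_sym lift_equiv_trans by blast
  then obtain b' where b': "b' \<in> U_all p" "mods p (cyc_sums b') = mods p (cyc_sums b)"
    "(op_step p)\<^sup>*\<^sup>* a b'"
    using assms(1) by (rule lift_equivE)
  with op_steps_same_sums [OF b'(1) assms(2) b'(2)] show ?thesis by simp
qed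

lemma altsum_map2:
  "length xs = length ys \<Longrightarrow> altsum (map2 (+) xs ys) = altsum xs + altsum ys"
  by (induction xs ys rule: list_induct2) auto

lemma altsum_snoc: "altsum (xs @ [x]) = altsum xs + (- 1) ^ length xs * x"
  by (induction xs) auto

text \<open>Rotating a list of even length by one place negates its alternating sum, so the two
  summands cancel. This supplies the divisibility needed in \<open>braid_dbl\<close>.\<close>

lemma altsum_cyc_sums: "even (length a) \<Longrightarrow> altsum (cyc_sums a) = 0"
  by (cases a) (auto simp: cyc_sums_def altsum_map2 altsum_snoc)

lemma braid_length: "braid p s t \<Longrightarrow> length t = length s"
proof (induction rule: rtranclp_induct)
  case (step t u)
  from step(2) have "length u = length t"
  proof cases
    case cong
    from arg_cong [OF this, of length] show ?thesis by simp
  qed simp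
  with step show ?case by simp
qed simp

section \<open>Moves between two-valued lists\<close>

lemma two_valued_modulus: "mods p (two_valued m k w p) = mods p (dbl (replicate m w))" if "k \<le> m"
proof -
  have "mods p (dbl (replicate k w @ replicate j (w + p))) = mods p (dbl (replicate (k + j) w))"
    for j
  proof (induction k)
    case 0
    show ?case by (induction j) auto
  qed auto
  from this [of "m - k"] that show ?thesis by (simp add: two_valued_def)
qed

lemma map_dbl: "map f (dbl ys) = dbl (map f ys)"
  by (induction ys) auto

lemma two_valued_shift: "lift_equiv p (two_valued m k w t) (two_valued m k (w + 2 * c) t)"
  using lift_equiv_shift [of p "two_valued m k w t" c]
  by (simp add: two_valued_def map_dbl algebra_simps)

lemma braid_dbl_reflect_all:
  "braid p (dbl (replicate k w @ z # zs)) (dbl (replicate k (2 * z - w) @ z # zs))"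
proof (induction k arbitrary: zs)
  case (Suc k)
  have "braid p (dbl (replicate (Suc k) w @ z # zs)) (dbl (w # z # replicate k w @ zs))"
    by (rule braid_dbl_perm) simp
  also have "braid p \<dots> (dbl ((2 * z - w) # z # replicate k w @ zs))"
    by (rule braid_dbl_reflect)
  also have "braid p \<dots> (dbl (replicate k w @ z # (2 * z - w) # zs))"
    by (rule braid_dbl_perm) simp
  also have "braid p \<dots> (dbl (replicate k (2 * z - w) @ z # (2 * z - w) # zs))"
    by (rule Suc.IH)
  also have "braid p \<dots> (dbl (replicate (Suc k) (2 * z - w) @ z # zs))"
    by (rule braid_dbl_perm) simp
  finally show ?case .
qed simp

text \<open>Reflecting all copies of \<open>w\<close> in \<open>w + t\<close> turns them into
  \<open>w + 2 * t\<close>, so \<open>w + t\<close> becomes the base value with multiplicity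
  \<open>m - k\<close>.\<close>

lemma two_valued_flip:
  assumes "k < m"
  shows "lift_equiv p (two_valued m k w t) (two_valued m (m - k) (w + t) t)"
proof (rule lift_equiv_braid)
  obtain l where l: "m - k = Suc l" using assms by (metis Suc_diff_Suc)
  have "braid p (two_valued m k w t)
      (dbl (replicate k (2 * (w + t) - w) @ (w + t) # replicate l (w + t)))"
    using braid_dbl_reflect_all [of p k w "w + t" "replicate l (w + t)"]
    by (simp add: two_valued_def l)
  also have "braid p \<dots> (two_valued m (m - k) (w + t) t)"
  proof -
    have "m - (m - k) = k" using assms by simp
    then show ?thesis
      unfolding two_valued_def by (simp only: l) (rule braid_dbl_perm, simp add: algebra_simps)
  qed
  finally show "braid p (two_valued m k w t) (two_valued m (m - k) (w + t) t)" .
qed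

text \<open>For odd \<open>p div t\<close> the number \<open>p + t\<close> is an even multiple of
  \<open>t\<close>. As long as another \<open>w\<close> and a \<open>w + t\<close> are left to
  reflect in, a translation thus carries \<open>w\<close> to \<open>w + t + p\<close>, which is
  \<open>w + t\<close> modulo \<open>p\<close>.\<close>

lemma braid_dbl_odd_quotient:
  assumes "t dvd p" "odd (p div t)"
  shows "braid p (dbl (replicate (Suc k) w @ replicate (Suc l) (w + t)))
    (dbl (w # replicate (k + Suc l) (w + t)))"
proof (induction k arbitrary: l)
  case (Suc k)
  define j where "j = (p div t + 1) div 2"
  have "2 * j = p div t + 1" unfolding j_def using assms(2) by (intro dvd_mult_div_cancel) simp
  then have j: "t * (2 * j) = p + t" using assms(1) by (simp add: distrib_left)
  have "braid p (dbl (replicate (Suc (Suc k)) w @ replicate (Suc l) (w + t)))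
      (dbl (w # w # (w + t) # replicate k w @ replicate l (w + t)))"
    by (rule braid_dbl_perm) simp
  also have "braid p \<dots>
      (dbl ((w + 2 * (w + t - w) * j) # w # (w + t) # replicate k w @ replicate l (w + t)))"
    by (rule braid_dbl_translate)
  also have "w + 2 * (w + t - w) * j = w + t + p" using j by (simp add: algebra_simps)
  also have "braid p (dbl ((w + t + p) # w # (w + t) # replicate k w @ replicate l (w + t)))
      (dbl ((w + t) # w # (w + t) # replicate k w @ replicate l (w + t)))"
    by (rule braid_cong) simp
  also have "braid p \<dots> (dbl (replicate (Suc k) w @ replicate (Suc (Suc l)) (w + t)))"
    by (rule braid_dbl_perm) simp
  also have "braid p \<dots> (dbl (w # replicate (k + Suc (Suc l)) (w + t)))"
    by (rule Suc.IH)
  finally show ?case by simp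
qed simp

lemma two_valued_odd_quotient:
  assumes "t dvd p" "odd (p div t)" "1 \<le> k" "k \<le> m" "k < m \<or> t = p"
  shows "lift_equiv p (two_valued m k w t) (two_valued m 1 w t)"
proof (cases "k < m")
  case True
  obtain k' where k': "k = Suc k'" using assms(3) by (cases k) auto
  obtain l where l: "m - k = Suc l" using True by (metis Suc_diff_Suc)
  have "k' + Suc l = m - 1" using k' l by simp
  then show ?thesis
    using lift_equiv_braid [OF braid_dbl_odd_quotient [OF assms(1,2), of k' w l]]
    by (simp only: two_valued_def l flip: k') (simp only: replicate_Suc append.simps One_nat_def replicate_0)
next
  \<comment> \<open>Here \<open>k = m\<close> and \<open>t = p\<close>: the list is constant modulo
    \<open>p\<close> for every multiplicity.\<close>
  case False
  then show ?thesis
    using assms two_valued_modulus [of k m p w] two_valued_modulus [of 1 m p w]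
    by (intro lift_equiv_cong) auto
qed

section \<open>Existence of normal forms\<close>

lemma U_subset_U_all: "a \<in> U p (2 * m) \<Longrightarrow> m \<ge> 1 \<Longrightarrow> a \<in> U_all p"
  by (auto simp: U_all_iff U_def)

lemma normal_form:
  assumes "a \<in> U p (2 * m)" "m \<ge> 1" "p \<ge> 1"
  obtains w t k where "1 \<le> t" "t dvd p" "1 \<le> k" "k < m \<or> k = m \<and> t = p"
    "lift_equiv p (cyc_sums a) (two_valued m k w t)"
proof -
  have len: "length (cyc_sums a) = 2 * m" using assms(1) by (simp add: U_def)
  moreover have "even (length a)" using assms(1) by (simp add: U_def)
  ultimately obtain ys where ys: "braid p (cyc_sums a) (dbl ys)"
    using braid_dbl [of "cyc_sums a" p] altsum_cyc_sums [of a] assms(2) by fastforce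
  have m: "length ys = m" using braid_length [OF ys] len by simp
  show thesis
  proof (cases "m = 1")
    \<comment> \<open>A single pair offers no difference to reduce; it counts as two-valued with
      \<open>k = m\<close> and \<open>t = p\<close>.\<close>
    case True
    then obtain y where "ys = [y]" using m by (cases ys) auto
    then show thesis using True ys assms(3)
      by (intro that [of p 1 y]) (auto intro: lift_equiv_braid simp: two_valued_def)
  next
    case False
    then have "m \<ge> 2" using assms(2) by simp
    from braid_dbl_two_valued [OF assms(3) m this] obtain w t k where
      "1 \<le> t" "t dvd p" "1 \<le> k" "k < m" "braid p (dbl ys) (two_valued m k w t)"
      unfolding two_valued_def by blast
    then show thesis using ys by (intro that [of t k w]) (auto intro: lift_equiv_braid)
  qed
qed

text \<open>All divisors of an odd \<open>p\<close> have odd quotients, so the multiplicity becomes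
  \<open>1\<close>. Adding \<open>p\<close> adjusts the parity of \<open>w\<close>, and an even
  shift then makes it \<open>0\<close>.\<close>

lemma normal_form_odd:
  assumes "a \<in> U p (2 * m)" "m \<ge> 1" "p \<ge> 1" "odd p"
  obtains t where "1 \<le> t" "t dvd p" "1 < m \<or> t = p"
    "lift_equiv p (cyc_sums a) (two_valued m 1 0 t)"
proof -
  obtain w t k where t: "1 \<le> t" "t dvd p" and k: "1 \<le> k" "k < m \<or> k = m \<and> t = p"
    and nf: "lift_equiv p (cyc_sums a) (two_valued m k w t)"
    using normal_form [OF assms(1-3)] .
  have "odd (p div t)" using assms(4) t(2) by (metis dvd_div_mult_self dvd_mult2)
  then have "lift_equiv p (two_valued m k w t) (two_valued m 1 w t)"
    using t k by (intro two_valued_odd_quotient) auto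
  moreover have "lift_equiv p (two_valued m 1 w t) (two_valued m 1 0 t)"
  proof -
    define v where "v = (if even w then w else w + p)"
    have "even v" using assms(4) by (simp add: v_def)
    then obtain c where c: "v = 2 * c" ..
    have "lift_equiv p (two_valued m 1 w t) (two_valued m 1 v t)"
      by (rule lift_equiv_cong)
        (simp add: two_valued_def v_def mods_def map_dbl add.assoc add.left_commute [of _ p])
    also have "lift_equiv p \<dots> (two_valued m 1 0 t)"
      using two_valued_shift [of p m 1 v t "- c"] c by simp
    finally show ?thesis .
  qed
  ultimately have "lift_equiv p (cyc_sums a) (two_valued m 1 0 t)"
    using nf lift_equiv_trans by blast
  then show thesis using that [of t] t k by auto
qed

lemma two_valued_mod2: "lift_equiv p (two_valued m k w t) (two_valued m k (w mod 2) t)"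
proof -
  have "w + 2 * (- (w div 2)) = w mod 2" by (simp flip: minus_mult_div_eq_mod)
  then show ?thesis using two_valued_shift [of p m k w t "- (w div 2)"] by simp
qed

text \<open>Even shifts leave only the parity of \<open>w\<close>. For odd \<open>t\<close> a flip
  replaces an odd \<open>w\<close> by the even \<open>w + t\<close>; for even \<open>t\<close> the
  parity stays as a parameter, and the multiplicity becomes \<open>1\<close> if
  \<open>p div t\<close> is odd.\<close>

lemma normal_form_even:
  assumes "a \<in> U p (2 * m)" "m \<ge> 1" "p \<ge> 1" "even p"
  obtains
    (odd) t k where "1 \<le> t" "t dvd p" "odd t" "1 \<le> k" "k < m"
      "lift_equiv p (cyc_sums a) (two_valued m k 0 t)"
  | (even_odd) t w where "1 \<le> t" "t dvd p" "even t" "odd (p div t)" "1 < m \<or> t = p"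
      "w \<in> {0, 1}" "lift_equiv p (cyc_sums a) (two_valued m 1 w t)"
  | (even_even) t k w where "1 \<le> t" "t dvd p" "even t" "even (p div t)" "1 \<le> k" "k < m"
      "w \<in> {0, 1}" "lift_equiv p (cyc_sums a) (two_valued m k w t)"
proof -
  obtain w t k where t: "1 \<le> t" "t dvd p" and k: "1 \<le> k" "k < m \<or> k = m \<and> t = p"
    and nf: "lift_equiv p (cyc_sums a) (two_valued m k w t)"
    using normal_form [OF assms(1-3)] .
  have w2: "w mod 2 \<in> {0, 1}" by auto
  have nf2: "lift_equiv p (cyc_sums a) (two_valued m k (w mod 2) t)"
    using nf two_valued_mod2 lift_equiv_trans by blast
  consider "odd t" | "even t" "odd (p div t)" | "even t" "even (p div t)" by blast
  then show thesis
  proof cases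
    case 1
    then have km: "k < m" using k assms(4) by auto
    show thesis
    proof (cases "even w")
      case True
      then show thesis using odd [OF t 1 k(1) km] nf2 by simp
    next
      case False
      have "lift_equiv p (cyc_sums a) (two_valued m (m - k) ((w + t) mod 2) t)"
        by (rule lift_equiv_trans [OF lift_equiv_trans [OF nf two_valued_flip [OF km]]
              two_valued_mod2])
      moreover have "(w + t) mod 2 = 0" using False 1 by presburger
      ultimately show thesis using odd [OF t 1, of "m - k"] k(1) km by simp
    qed
  next
    case 2
    then have "lift_equiv p (two_valued m k (w mod 2) t) (two_valued m 1 (w mod 2) t)"
      using t k by (intro two_valued_odd_quotient) auto
    then have "lift_equiv p (cyc_sums a) (two_valued m 1 (w mod 2) t)"
      using nf2 lift_equiv_trans by blast
    then show thesis using even_odd [OF t 2 _ w2] k by auto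
  next
    case 3
    \<comment> \<open>For \<open>t = p\<close> the quotient would be \<open>1\<close>, which is odd;
      so \<open>k = m\<close> cannot occur.\<close>
    have "t \<noteq> p" using 3(2) t(1) by auto
    then show thesis using even_even [OF t 3 k(1) _ w2 nf2] k(2) by auto
  qed
qed

text \<open>The flip moves the base value by the even number \<open>t\<close>, so a shift undoes
  this. It accounts for the sign lost in \<open>mu_tau\<close>.\<close>

lemma two_valued_complement:
  assumes "k < m" "even t"
  shows "lift_equiv p (two_valued m k w t) (two_valued m (m - k) w t)"
proof -
  obtain c where "t = 2 * c" using assms(2) ..
  then show ?thesis
    using two_valued_flip [OF assms(1), of p w t] two_valued_shift [of p m "m - k" "w + t" t "- c"]
    by (auto intro: lift_equiv_trans)
qed

fun interleave_zero :: "int \<Rightarrow> int list \<Rightarrow> int list" where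
  "interleave_zero p [] = []"
| "interleave_zero p (y # ys) = 0 # (y mod p) # interleave_zero p ys"

text \<open>In the tuple \<open>0, y1, 0, y2, ...\<close> every \<open>y\<close> stands cyclically
  between two zeros and so appears as two adjacent sums. This later shows that the classes are
  nonempty.\<close>

lemma ex_cyc_sums_dbl:
  assumes "p \<ge> 1"
  shows "\<exists>a\<in>U p (2 * length ys). mods p (cyc_sums a) = mods p (dbl ys)"
proof
  let ?f = "interleave_zero p"
  have "map2 (+) (?f ys) (tl (?f ys) @ [0]) = mods p (dbl ys)" if "ys \<noteq> []" for ys
    using that
  proof (induction ys)
    case (Cons y ys)
    then show ?case by (cases ys) auto
  qed simp
  moreover have "rotate1 (?f ys) = tl (?f ys) @ [0]" if "ys \<noteq> []" for ys
    using that by (cases ys) auto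
  ultimately have "cyc_sums (?f ys) = mods p (dbl ys)"
    by (cases "ys = []") (simp_all add: cyc_sums_def)
  moreover have "mods p (mods p s) = mods p s" for s by (simp add: mods_def)
  ultimately show "mods p (cyc_sums (?f ys)) = mods p (dbl ys)" by simp
  have "length (?f ys) = 2 * length ys" "set (?f ys) \<subseteq> {0..<p}"
    using assms by (induction ys) auto
  then show "?f ys \<in> U p (2 * length ys)" by (simp add: U_def)
qed

lemma ex_two_valued:
  assumes "p \<ge> 1" "k \<le> m"
  obtains a where "a \<in> U p (2 * m)" "lift_equiv p (cyc_sums a) (two_valued m k w t)"
proof -
  obtain a where "a \<in> U p (2 * m)" "mods p (cyc_sums a) = mods p (two_valued m k w t)"
    using ex_cyc_sums_dbl [OF assms(1), of "replicate k w @ replicate (m - k) (w + t)"] assms(2)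
    unfolding two_valued_def by auto
  then show thesis using that lift_equiv_cong by blast
qed

section \<open>Invariants of a tuple read off from its normal form\<close>

context
  fixes p t w :: int and m k :: nat and a :: "int list"
  assumes a: "a \<in> U p (2 * m)" and p: "p \<ge> 1" and k: "1 \<le> k" "k \<le> m"
    and t: "1 \<le> t" "t dvd p"
    and nf: "lift_equiv p (cyc_sums a) (two_valued m k w t)"
begin

lemma tau_normal_form:
  assumes "k < m \<or> t = p"
  shows "tau p a = t"
proof -
  have "a \<in> U_all p" using U_subset_U_all [OF a] k by simp
  then obtain b where "mods p (cyc_sums b) = mods p (two_valued m k w t)" "(op_step p)\<^sup>*\<^sup>* a b"
    using lift_equivE [OF nf] by metis
  then show ?thesis using tau_two_valued [of p b m k w t] op_steps_tau assms t k p by metis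
qed

lemma mu_normal_form:
  assumes "even p" "even w" "odd t"
  shows "mu a = 4 * int k - 2 * int m"
proof -
  have "a \<in> U_all p" using U_subset_U_all [OF a] k by simp
  then obtain b where "mods p (cyc_sums b) = mods p (two_valued m k w t)" "(op_step p)\<^sup>*\<^sup>* a b"
    using lift_equivE [OF nf] by metis
  then show ?thesis using mu_two_valued [of p b m k w t] op_steps_mu assms k by metis
qed

lemma eps_normal_form:
  assumes "even p" "even t"
  shows "eps a = (if even w then 0 else 1)"
proof -
  have "a \<in> U_all p" using U_subset_U_all [OF a] k by simp
  then obtain b where "mods p (cyc_sums b) = mods p (two_valued m k w t)" "(op_step p)\<^sup>*\<^sup>* a b"
    using lift_equivE [OF nf] by metis
  then show ?thesis using eps_two_valued [of p b m k w t] op_steps_eps assms k by metis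
qed

lemma mu_tau_normal_form:
  assumes "2 * t dvd p" "k < m"
  shows "mu_tau p t a = enat (nat \<bar>4 * int k - 2 * int m\<bar>)"
proof -
  have "a \<in> U_all p" using U_subset_U_all [OF a] k by simp
  then obtain b where "b \<in> U_all p" "mods p (cyc_sums b) = mods p (two_valued m k w t)"
    "(op_step p)\<^sup>*\<^sup>* a b"
    using lift_equivE [OF nf] by metis
  then show ?thesis
    using mu_tau_two_valued [of p b m k w t] op_steps_mu_tau [of p a b t] assms t k p by metis
qed

end

text \<open>In the third condition, one direction is invariance of the class under \<open>r\<close>
  and the other is completeness of the invariants.\<close>

lemma quotient_eqI:
  assumes "\<Union>\<C> = A" "{} \<notin> \<C>"
    and "\<And>C a b. C \<in> \<C> \<Longrightarrow> a \<in> C \<Longrightarrow> (a, b) \<in> r \<longleftrightarrow> b \<in> C"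
  shows "A // r = \<C>"
proof -
  have "r `` {a} = C" if "C \<in> \<C>" "a \<in> C" for a C using assms(3) [OF that] by auto
  then show ?thesis unfolding quotient_def using assms(1,2) by (auto; metis UnionI all_not_in_conv)
qed

section \<open>The classification\<close>

text \<open>Together the two congruences say that 4 divides
  \<open>2 * m - \<bar>\<mu>\<bar>\<close>. As \<open>\<mu>\<close> is even, its sign is irrelevant
  modulo 4, so \<open>k\<close> is the quotient of \<open>\<mu> + 2 * m\<close> by 4.\<close>

lemma mu_range_iff:
  "(\<exists>k. 1 \<le> k \<and> k < m \<and> \<mu> = 4 * int k - 2 * int m) \<longleftrightarrow>
    - int (2 * m) < \<mu> \<and> \<mu> < int (2 * m) \<and> [\<mu> = 0] (mod 2) \<and>
      [(int (2 * m) - \<bar>\<mu>\<bar>) div 2 = 0] (mod 2)"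
proof
  assume "\<exists>k. 1 \<le> k \<and> k < m \<and> \<mu> = 4 * int k - 2 * int m"
  then obtain k where k: "1 \<le> k" "k < m" "\<mu> = 4 * int k - 2 * int m" by blast
  have "int (2 * m) - \<bar>\<mu>\<bar> = 4 * (int m - int k) \<or> int (2 * m) - \<bar>\<mu>\<bar> = 4 * int k"
    using k(3) by (cases "\<mu> \<ge> 0") auto
  then have "4 dvd int (2 * m) - \<bar>\<mu>\<bar>" by (metis dvd_triv_left)
  then have "even ((int (2 * m) - \<bar>\<mu>\<bar>) div 2)" by presburger
  then show "- int (2 * m) < \<mu> \<and> \<mu> < int (2 * m) \<and> [\<mu> = 0] (mod 2) \<and>
      [(int (2 * m) - \<bar>\<mu>\<bar>) div 2 = 0] (mod 2)"
    using k by (auto simp: cong_0_iff)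
next
  assume *: "- int (2 * m) < \<mu> \<and> \<mu> < int (2 * m) \<and> [\<mu> = 0] (mod 2) \<and>
      [(int (2 * m) - \<bar>\<mu>\<bar>) div 2 = 0] (mod 2)"
  define k where "k = nat ((\<mu> + 2 * int m) div 4)"
  have "4 * ((\<mu> + 2 * int m) div 4) = \<mu> + 2 * int m"
    using * unfolding cong_def by presburger
  then show "\<exists>k. 1 \<le> k \<and> k < m \<and> \<mu> = 4 * int k - 2 * int m"
    using * by (intro exI [of _ k]) (auto simp: k_def)
qed

lemma two_dvd_of_even_quotient: "t dvd p \<Longrightarrow> even (p div t) \<Longrightarrow> 2 * t dvd p" for p t :: int
  by (metis dvd_mult_div_cancel mult.commute mult_dvd_mono dvd_refl)

lemma sim_iff:
  "a \<in> U p (2 * m) \<Longrightarrow> m \<ge> 1 \<Longrightarrow> (a, b) \<in> sim p \<longleftrightarrow> (op_step p)\<^sup>*\<^sup>* a b"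
  using U_subset_U_all [of a p m] op_steps_U_all [of p a b] by (auto simp: sim_def)

lemma op_steps_U:
  "a \<in> U p (2 * m) \<Longrightarrow> m \<ge> 1 \<Longrightarrow> (op_step p)\<^sup>*\<^sup>* a b \<Longrightarrow> b \<in> U p (2 * m)"
  using U_subset_U_all [of a p m] op_steps_U_all [of p a b] by (auto simp: U_def U_all_iff)

lemma op_steps_same_tau_odd:
  assumes "a \<in> U p (2 * m)" "b \<in> U p (2 * m)" "m \<ge> 1" "p \<ge> 1" "odd p" "tau p a = tau p b"
  shows "(op_step p)\<^sup>*\<^sup>* a b"
proof -
  have nf: "lift_equiv p (cyc_sums c) (two_valued m 1 0 (tau p c))" if "c \<in> U p (2 * m)" for c
    using normal_form_odd [OF that assms(3-5)] tau_normal_form [OF that assms(4) _ assms(3)]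
    by (metis order_refl)
  show ?thesis
    using op_steps_lift_equiv [OF _ _ nf [OF assms(1)]] nf [OF assms(2)] assms U_subset_U_all
    by metis
qed

text \<open>Here and in the next two lemmas, \<open>tau\<close> selects the case of
  \<open>normal_form_even\<close>, and the remaining invariants fix the parameters \<open>k\<close>
  and \<open>w\<close>.\<close>

lemma alpha_normal_form:
  assumes "a \<in> alpha_class p (2 * m) t (4 * int k - 2 * int m)" "odd t" "even p" "m \<ge> 1" "p \<ge> 1"
  shows "lift_equiv p (cyc_sums a) (two_valued m k 0 t)"
proof -
  have a: "a \<in> U p (2 * m)" "tau p a = t" "mu a = 4 * int k - 2 * int m"
    using assms(1) by (auto simp: alpha_class_def)
  note tau = tau_normal_form [OF a(1) assms(5)]
  from a(1) assms(4,5,3) show ?thesis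
  proof (cases rule: normal_form_even)
    case (odd t' k')
    then have "t' = t" "4 * int k' - 2 * int m = 4 * int k - 2 * int m"
      using tau [of k' t' 0] mu_normal_form [OF a(1) assms(5), of k' t' 0] a assms(3) by auto
    then show ?thesis using odd by simp
  next
    case (even_odd t' w)
    then show ?thesis using tau [of 1 t' w] a assms(2,4) by auto
  next
    case (even_even t' k' w)
    then show ?thesis using tau [of k' t' w] a assms(2) by auto
  qed
qed

lemma beta_normal_form:
  assumes "a \<in> beta_class p (2 * m) t e" "even t" "odd (p div t)" "even p" "m \<ge> 1" "p \<ge> 1"
  shows "lift_equiv p (cyc_sums a) (two_valued m 1 (if e = 0 then 0 else 1) t)"
proof -
  have a: "a \<in> U p (2 * m)" "tau p a = t" "eps a = e"
    using assms(1) by (auto simp: beta_class_def)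
  note tau = tau_normal_form [OF a(1) assms(6)]
  from a(1) assms(5,6,4) show ?thesis
  proof (cases rule: normal_form_even)
    case (odd t' k')
    then show ?thesis using tau [of k' t' 0] a assms(2) by auto
  next
    case (even_odd t' w)
    then have "t' = t" using tau [of 1 t' w] a assms(5) by auto
    moreover have "w = (if e = 0 then 0 else 1)"
      using eps_normal_form [OF a(1) assms(6), of 1 t' w] even_odd a(3) assms(4,5) by auto
    ultimately show ?thesis using even_odd by simp
  next
    case (even_even t' k' w)
    then show ?thesis using tau [of k' t' w] a assms(3) by auto
  qed
qed

lemma gamma_normal_form:
  assumes "a \<in> gamma_class p (2 * m) t e \<mu>" "even t" "even (p div t)" "even p" "m \<ge> 1" "p \<ge> 1"
    and "\<mu> = \<bar>4 * int k - 2 * int m\<bar>" "k < m"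
  shows "lift_equiv p (cyc_sums a) (two_valued m k (if e = 0 then 0 else 1) t)"
proof -
  have a: "a \<in> U p (2 * m)" "tau p a = t" "eps a = e" "mu_tau p t a = enat (nat \<mu>)"
    using assms(1) by (auto simp: gamma_class_def)
  note tau = tau_normal_form [OF a(1) assms(6)]
  from a(1) assms(5,6,4) show ?thesis
  proof (cases rule: normal_form_even)
    case (odd t' k')
    then show ?thesis using tau [of k' t' 0] a assms(2) by auto
  next
    case (even_odd t' w)
    then show ?thesis using tau [of 1 t' w] a assms(3,5) by auto
  next
    case (even_even t' k' w)
    then have t: "t' = t" using tau [of k' t' w] a by auto
    have w: "w = (if e = 0 then 0 else 1)"
      using eps_normal_form [OF a(1) assms(6), of k' t' w] even_even a(3) assms(4) by auto
    have "2 * t dvd p" using even_even t two_dvd_of_even_quotient by blast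
    then have "nat \<mu> = nat \<bar>4 * int k' - 2 * int m\<bar>"
      using mu_tau_normal_form [OF a(1) assms(6), of k' t' w] even_even a(4) t by auto
    \<comment> \<open>The absolute value determines the multiplicity only up to exchanging
      \<open>k\<close> and \<open>m - k\<close>; \<open>two_valued_complement\<close> bridges the
      two.\<close>
    then have "k' = k \<or> k' = m - k" using assms(7,8) even_even(6) by linarith
    then show ?thesis
    proof
      assume "k' = m - k"
      moreover have "lift_equiv p (two_valued m k' w t) (two_valued m (m - k') w t)"
        using two_valued_complement even_even(6) assms(2) .
      ultimately show ?thesis
        using even_even(8) lift_equiv_trans assms(8) unfolding t w by (metis diff_diff_cancel less_imp_le)
    qed (use even_even t w in simp)
  qed
qed

theorem theorem3p2:
  fixes p :: int and n :: nat
  assumes "p \<ge> 2" and "n > 0" and "even n"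
  shows
    "(n = 2 \<longrightarrow>
       (odd p \<longrightarrow> U p 2 // sim p = {U p 2}) \<and>
       (even p \<longrightarrow> U p 2 // sim p = {eta_class p e | e. e \<in> {0, 1}})) \<and>
     (n > 2 \<longrightarrow>
       (odd p \<longrightarrow> U p n // sim p = {delta_class p n t | t. t \<in> {1..p} \<and> t dvd p}) \<and>
       (even p \<longrightarrow> U p n // sim p =
          {alpha_class p n t m | t m. t \<in> {1..p} \<and> t dvd p \<and> odd t \<and>
             - int n < m \<and> m < int n \<and> [m = 0] (mod 2) \<and> [(int n - \<bar>m\<bar>) div 2 = 0] (mod 2)} \<union>
          {beta_class p n t e | t e. t \<in> {1..p} \<and> t dvd p \<and> even t \<and> odd (p div t) \<and>
             e \<in> {0, 1}} \<union>
          {gamma_class p n t e m | t e m. t \<in> {1..p} \<and> t dvd p \<and> even t \<and> even (p div t) \<and>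
             e \<in> {0, 1} \<and>
             0 \<le> m \<and> m < int n \<and> [m = 0] (mod 2) \<and> [(int n - \<bar>m\<bar>) div 2 = 0] (mod 2)}))"
proof -
  obtain m where n: "n = 2 * m" and m: "m \<ge> 1" using assms(2,3) by (auto elim!: evenE)
  have p: "p \<ge> 1" using assms(1) by simp
  have eq: "(op_step p)\<^sup>*\<^sup>* a b"
    if "a \<in> U p (2 * m)" "b \<in> U p (2 * m)" "lift_equiv p (cyc_sums a) s"
      "lift_equiv p (cyc_sums b) s" for a b s
    using op_steps_lift_equiv that U_subset_U_all m by blast
  note sim = sim_iff [OF _ m] and U = op_steps_U [OF _ m]
  \<comment> \<open>The condition \<open>1 < m \<or> t = p\<close>, here and in \<open>?B\<close>,
    treats \<open>n = 2\<close> and \<open>n > 2\<close> together: a single pair admits only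
    \<open>t = p\<close>.\<close>
  have delta: "U p n // sim p = {delta_class p n t | t. t \<in> {1..p} \<and> t dvd p \<and> (1 < m \<or> t = p)}"
    if po: "odd p"
  proof (rule quotient_eqI)
    show "\<Union> {delta_class p n t |t. t \<in> {1..p} \<and> t dvd p \<and> (1 < m \<or> t = p)} = U p n"
    proof (intro subset_antisym subsetI)
      fix a assume a: "a \<in> U p n"
      then obtain t where t: "1 \<le> t" "t dvd p" "1 < m \<or> t = p"
        "lift_equiv p (cyc_sums a) (two_valued m 1 0 t)"
        using normal_form_odd [OF _ m p po] unfolding n by metis
      then have "tau p a = t" using tau_normal_form [OF a [unfolded n] p, of 1 t 0] m by simp
      then have "a \<in> delta_class p n t" using a by (simp add: delta_class_def)
      moreover have "t \<le> p" using t(2) p by (simp add: zdvd_imp_le)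
      ultimately show "a \<in> \<Union> {delta_class p n t |t. t \<in> {1..p} \<and> t dvd p \<and> (1 < m \<or> t = p)}"
        using t by auto
    qed (auto simp: delta_class_def)
    show "{} \<notin> {delta_class p n t |t. t \<in> {1..p} \<and> t dvd p \<and> (1 < m \<or> t = p)}"
    proof
      assume "{} \<in> {delta_class p n t |t. t \<in> {1..p} \<and> t dvd p \<and> (1 < m \<or> t = p)}"
      then obtain t where t: "delta_class p n t = {}" "1 \<le> t" "t dvd p" "1 < m \<or> t = p" by auto
      obtain a where "a \<in> U p (2 * m)" "lift_equiv p (cyc_sums a) (two_valued m 1 0 t)"
        using ex_two_valued [OF p m] .
      then have "a \<in> delta_class p n t"
        using tau_normal_form [of a p m 1 t 0] t p m by (simp add: delta_class_def n)
      with t show False by simp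
    qed
  next
    fix C a b assume "C \<in> {delta_class p n t |t. t \<in> {1..p} \<and> t dvd p \<and> (1 < m \<or> t = p)}" "a \<in> C"
    then obtain t where C: "C = delta_class p n t" and a: "a \<in> U p (2 * m)" "tau p a = t"
      by (auto simp: delta_class_def n)
    show "(a, b) \<in> sim p \<longleftrightarrow> b \<in> C"
      unfolding sim [OF a(1)] C delta_class_def n
      using U [OF a(1)] op_steps_tau [of p a b] op_steps_same_tau_odd [OF a(1) _ m p po] a(2) by auto
  qed
  let ?A = "{alpha_class p n t m | t m. t \<in> {1..p} \<and> t dvd p \<and> odd t \<and>
             - int n < m \<and> m < int n \<and> [m = 0] (mod 2) \<and> [(int n - \<bar>m\<bar>) div 2 = 0] (mod 2)}"
  let ?B = "{beta_class p n t e | t e. t \<in> {1..p} \<and> t dvd p \<and> even t \<and> odd (p div t) \<and>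
             e \<in> {0, 1} \<and> (1 < m \<or> t = p)}"
  let ?G = "{gamma_class p n t e m | t e m. t \<in> {1..p} \<and> t dvd p \<and> even t \<and> even (p div t) \<and>
             e \<in> {0, 1} \<and>
             0 \<le> m \<and> m < int n \<and> [m = 0] (mod 2) \<and> [(int n - \<bar>m\<bar>) div 2 = 0] (mod 2)}"
  have range_abs: "0 \<le> \<bar>\<mu>\<bar> \<and> \<bar>\<mu>\<bar> < int n \<and> [\<bar>\<mu>\<bar> = 0] (mod 2) \<and>
      [(int n - \<bar>\<bar>\<mu>\<bar>\<bar>) div 2 = 0] (mod 2)"
    if "- int n < \<mu> \<and> \<mu> < int n \<and> [\<mu> = 0] (mod 2) \<and> [(int n - \<bar>\<mu>\<bar>) div 2 = 0] (mod 2)" for \<mu>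
    using that by (auto simp: cong_0_iff)
  \<comment> \<open>In the case \<open>gamma\<close> the range of \<open>\<mu>\<close> is stated
    with both bounds, so that \<open>mu_range_iff\<close> applies to it just as in the case
    \<open>alpha\<close>.\<close>
  have family_cases [consumes 1, case_names alpha beta gamma]: P
    if C: "C \<in> ?A \<union> ?B \<union> ?G"
      and alpha: "\<And>t \<mu>. C = alpha_class p n t \<mu> \<Longrightarrow> 1 \<le> t \<Longrightarrow> t dvd p \<Longrightarrow> odd t \<Longrightarrow>
        - int n < \<mu> \<and> \<mu> < int n \<and> [\<mu> = 0] (mod 2) \<and>
          [(int n - \<bar>\<mu>\<bar>) div 2 = 0] (mod 2) \<Longrightarrow> P"
      and beta: "\<And>t e. C = beta_class p n t e \<Longrightarrow> 1 \<le> t \<Longrightarrow> t dvd p \<Longrightarrow> even t \<Longrightarrow>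
        odd (p div t) \<Longrightarrow> e \<in> {0, 1} \<Longrightarrow> 1 < m \<or> t = p \<Longrightarrow> P"
      and gamma: "\<And>t e \<mu>. C = gamma_class p n t e \<mu> \<Longrightarrow> 1 \<le> t \<Longrightarrow> t dvd p \<Longrightarrow> even t \<Longrightarrow>
        even (p div t) \<Longrightarrow> e \<in> {0, 1} \<Longrightarrow> 0 \<le> \<mu> \<Longrightarrow>
        - int n < \<mu> \<and> \<mu> < int n \<and> [\<mu> = 0] (mod 2) \<and>
          [(int n - \<bar>\<mu>\<bar>) div 2 = 0] (mod 2) \<Longrightarrow> P"
    for C P
    using C
  proof (elim UnE)
    assume "C \<in> ?A"
    then obtain t \<mu> where "C = alpha_class p n t \<mu> \<and> t \<in> {1..p} \<and> t dvd p \<and> odd t \<and>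
        - int n < \<mu> \<and> \<mu> < int n \<and> [\<mu> = 0] (mod 2) \<and>
          [(int n - \<bar>\<mu>\<bar>) div 2 = 0] (mod 2)"
      by (elim CollectE exE) (rule that)
    then show P by (intro alpha [of t \<mu>]) simp_all
  next
    assume "C \<in> ?B"
    then obtain t e where "C = beta_class p n t e \<and> t \<in> {1..p} \<and> t dvd p \<and> even t \<and>
        odd (p div t) \<and> e \<in> {0, 1} \<and> (1 < m \<or> t = p)"
      by (elim CollectE exE) (rule that)
    then show P by (intro beta [of t e]) simp_all
  next
    assume "C \<in> ?G"
    then obtain t e \<mu> where "C = gamma_class p n t e \<mu> \<and> t \<in> {1..p} \<and> t dvd p \<and> even t \<and>
        even (p div t) \<and> e \<in> {0, 1} \<and> 0 \<le> \<mu> \<and> \<mu> < int n \<and> [\<mu> = 0] (mod 2) \<and>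
        [(int n - \<bar>\<mu>\<bar>) div 2 = 0] (mod 2)"
      by (elim CollectE exE) (rule that)
    then show P by (intro gamma [of t e \<mu>] conjI; elim conjE; (assumption | simp))
  qed
  have main: "U p n // sim p = ?A \<union> ?B \<union> ?G" if "even p"
  proof (rule quotient_eqI)
    show "\<Union> (?A \<union> ?B \<union> ?G) = U p n"
    proof (intro subset_antisym subsetI)
      fix a assume a: "a \<in> U p n"
      note a' = a [unfolded n]
      from a' m p that show "a \<in> \<Union> (?A \<union> ?B \<union> ?G)"
      proof (cases rule: normal_form_even)
        case (odd t k)
        have elem: "a \<in> alpha_class p n t (4 * int k - 2 * int m)"
          using tau_normal_form [OF a' p, of k t 0] mu_normal_form [OF a' p, of k t 0] odd that a
          by (simp add: alpha_class_def)
        have "alpha_class p n t (4 * int k - 2 * int m) \<in> ?A"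
        proof -
          let ?\<mu> = "4 * int k - 2 * int m"
          have "- int n < ?\<mu> \<and> ?\<mu> < int n \<and> [?\<mu> = 0] (mod 2) \<and>
              [(int n - \<bar>?\<mu>\<bar>) div 2 = 0] (mod 2)"
            using odd(4,5) mu_range_iff [of m ?\<mu>] unfolding n by blast
          moreover have "t \<in> {1..p}" using odd p by (simp add: zdvd_imp_le)
          ultimately show ?thesis
            using odd(2,3) by (intro CollectI exI [of _ t] exI [of _ ?\<mu>] conjI refl) simp_all
        qed
        then show ?thesis using elem by (intro UnionI [OF UnI1 [OF UnI1]])
      next
        case (even_odd t w)
        have elem: "a \<in> beta_class p n t (if even w then 0 else 1)"
          using tau_normal_form [OF a' p, of 1 t w] eps_normal_form [OF a' p, of 1 t w]
            even_odd that a m by (simp add: beta_class_def)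
        have "beta_class p n t (if even w then 0 else 1) \<in> ?B"
        proof -
          have "t \<in> {1..p}" using even_odd p by (simp add: zdvd_imp_le)
          moreover have "(if even w then 0 else 1) \<in> {0, 1 :: enat}" by simp
          ultimately show ?thesis using even_odd(2-5)
            by (intro CollectI exI [of _ t] exI [of _ "if even w then 0 else 1"] conjI refl) simp_all
        qed
        then show ?thesis using elem by (intro UnionI [OF UnI1 [OF UnI2]])
      next
        case (even_even t k w)
        let ?\<mu> = "4 * int k - 2 * int m"
        have "2 * t dvd p" using even_even two_dvd_of_even_quotient by blast
        then have elem: "a \<in> gamma_class p n t (if even w then 0 else 1) \<bar>?\<mu>\<bar>"
          using tau_normal_form [OF a' p, of k t w] eps_normal_form [OF a' p, of k t w]
            mu_tau_normal_form [OF a' p, of k t w] even_even that a by (simp add: gamma_class_def)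
        have "gamma_class p n t (if even w then 0 else 1) \<bar>?\<mu>\<bar> \<in> ?G"
        proof -
          have "- int n < ?\<mu> \<and> ?\<mu> < int n \<and> [?\<mu> = 0] (mod 2) \<and>
              [(int n - \<bar>?\<mu>\<bar>) div 2 = 0] (mod 2)"
            using even_even(5,6) mu_range_iff [of m ?\<mu>] unfolding n by blast
          note range_abs [OF this]
          moreover have "t \<in> {1..p}" using even_even p by (simp add: zdvd_imp_le)
          moreover have "(if even w then 0 else 1) \<in> {0, 1 :: enat}" by simp
          ultimately show ?thesis using even_even(2-4)
            by (intro CollectI exI [of _ t] exI [of _ "if even w then 0 else 1"]
                exI [of _ "\<bar>?\<mu>\<bar>"] conjI refl) simp_all
        qed
        then show ?thesis using elem by (intro UnionI [OF UnI2])
      qed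
    qed (auto simp: alpha_class_def beta_class_def gamma_class_def)
    show "{} \<notin> ?A \<union> ?B \<union> ?G"
    proof
      assume "{} \<in> ?A \<union> ?B \<union> ?G"
      then show False
      proof (cases rule: family_cases)
        case (alpha t \<mu>)
        then obtain k where k: "1 \<le> k" "k < m" "\<mu> = 4 * int k - 2 * int m"
          using mu_range_iff [of m \<mu>] unfolding n by blast
        obtain a where "a \<in> U p (2 * m)" "lift_equiv p (cyc_sums a) (two_valued m k 0 t)"
          using ex_two_valued [OF p less_imp_le [OF k(2)]] .
        then have "a \<in> alpha_class p n t \<mu>"
          using tau_normal_form [of a p m k t 0] mu_normal_form [of a p m k t 0] alpha k p that
          by (simp add: alpha_class_def n)
        with alpha show False by simp
      next
        case (beta t e)
        let ?w = "if e = 0 then 0 else 1 :: int"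
        obtain a where "a \<in> U p (2 * m)" "lift_equiv p (cyc_sums a) (two_valued m 1 ?w t)"
          using ex_two_valued [OF p m] .
        then have "a \<in> beta_class p n t e"
          using tau_normal_form [of a p m 1 t ?w] eps_normal_form [of a p m 1 t ?w] beta p m that
          by (auto simp: beta_class_def n)
        with beta show False by simp
      next
        case (gamma t e \<mu>)
        let ?w = "if e = 0 then 0 else 1 :: int"
        obtain k where k: "1 \<le> k" "k < m" "\<mu> = 4 * int k - 2 * int m"
          using gamma mu_range_iff [of m \<mu>] unfolding n by blast
        obtain a where "a \<in> U p (2 * m)" "lift_equiv p (cyc_sums a) (two_valued m k ?w t)"
          using ex_two_valued [OF p less_imp_le [OF k(2)]] .
        moreover have "2 * t dvd p" using gamma two_dvd_of_even_quotient by blast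
        ultimately have "a \<in> gamma_class p n t e \<mu>"
          using tau_normal_form [of a p m k t ?w] eps_normal_form [of a p m k t ?w]
            mu_tau_normal_form [of a p m k t ?w] gamma k p that
          by (auto simp: gamma_class_def n)
        with gamma show False by simp
      qed
    qed
  next
    fix C a b assume C: "C \<in> ?A \<union> ?B \<union> ?G" and aC: "a \<in> C"
    from C show "(a, b) \<in> sim p \<longleftrightarrow> b \<in> C"
    proof (cases rule: family_cases)
      case (alpha t \<mu>)
      have a: "a \<in> U p (2 * m)" using aC alpha by (simp add: alpha_class_def n)
      obtain k where k: "\<mu> = 4 * int k - 2 * int m"
        using alpha mu_range_iff [of m \<mu>] unfolding n by blast
      have "(op_step p)\<^sup>*\<^sup>* a b" if "b \<in> C"
        using alpha_normal_form [of _ p m t k] aC that alpha \<open>even p\<close> m p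
        by (intro eq [of a b "two_valued m k 0 t"]) (auto simp: a n k alpha_class_def)
      moreover have "b \<in> C" if "(op_step p)\<^sup>*\<^sup>* a b"
        using U [OF a that] op_steps_tau [OF that] op_steps_mu [OF that \<open>even p\<close>] aC alpha
        by (simp add: alpha_class_def n)
      ultimately show ?thesis unfolding sim [OF a] by blast
    next
      case (beta t e)
      have a: "a \<in> U p (2 * m)" using aC beta by (simp add: beta_class_def n)
      have "(op_step p)\<^sup>*\<^sup>* a b" if "b \<in> C"
        using beta_normal_form [of _ p m t e] aC that beta \<open>even p\<close> m p
        by (intro eq [of a b "two_valued m 1 (if e = 0 then 0 else 1) t"])
          (auto simp: a n beta_class_def)
      moreover have "b \<in> C" if "(op_step p)\<^sup>*\<^sup>* a b"
        using U [OF a that] op_steps_tau [OF that] op_steps_eps [OF that \<open>even p\<close>] aC beta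
        by (simp add: beta_class_def n)
      ultimately show ?thesis unfolding sim [OF a] by blast
    next
      case (gamma t e \<mu>)
      have a: "a \<in> U p (2 * m)" using aC gamma by (simp add: gamma_class_def n)
      obtain k where k: "k < m" "\<mu> = \<bar>4 * int k - 2 * int m\<bar>"
        using gamma mu_range_iff [of m \<mu>] unfolding n by (metis abs_of_nonneg)
      have "2 * t dvd p" using gamma two_dvd_of_even_quotient by blast
      have "(op_step p)\<^sup>*\<^sup>* a b" if "b \<in> C"
        using gamma_normal_form [OF _ gamma(4,5) \<open>even p\<close> m p k(2,1), of _ e] aC that
        by (intro eq [of a b "two_valued m k (if e = 0 then 0 else 1) t"])
          (auto simp: a n gamma(1) gamma_class_def)
      moreover have "b \<in> C" if "(op_step p)\<^sup>*\<^sup>* a b"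
        using U [OF a that] op_steps_tau [OF that] op_steps_eps [OF that \<open>even p\<close>]
          op_steps_mu_tau [OF that gamma(2) \<open>2 * t dvd p\<close> p] aC gamma
        by (simp add: gamma_class_def n)
      ultimately show ?thesis unfolding sim [OF a] by blast
    qed
  qed
  show ?thesis
  proof (intro conjI impI)
    assume "n = 2" "odd p"
    then have "m = 1" and "U p 2 // sim p = {delta_class p 2 p}"
      using delta p n by auto
    \<comment> \<open>With one pair the normal form has \<open>t = p\<close>, so \<open>tau\<close>
      is constant.\<close>
    moreover have "delta_class p 2 p = U p 2"
    proof -
      have "tau p a = p" if "a \<in> U p 2" for a
        using normal_form_odd [of a p m] tau_normal_form [of a p m 1 p 0] that \<open>odd p\<close> p
        unfolding \<open>m = 1\<close> by (metis less_irrefl mult.right_neutral order_refl)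
      then show ?thesis by (auto simp: delta_class_def)
    qed
    ultimately show "U p 2 // sim p = {U p 2}" by simp
  next
    assume "n = 2" "even p"
    then have "m = 1" using n by simp
    have "tau p a = p" if a: "a \<in> U p 2" for a
    proof -
      have a': "a \<in> U p (2 * m)" using a \<open>m = 1\<close> by simp
      from a' m p \<open>even p\<close> show ?thesis
        by (cases rule: normal_form_even)
          (use \<open>m = 1\<close> tau_normal_form [OF a' p, of 1 p] p in auto)
    qed
    then have "beta_class p n p e = eta_class p e" for e
      by (auto simp: beta_class_def eta_class_def \<open>n = 2\<close>)
    then have B: "?B = {eta_class p e | e. e \<in> {0, 1}}"
      using \<open>m = 1\<close> \<open>even p\<close> p by auto
    \<comment> \<open>For \<open>n = 2\<close> the only even \<open>\<mu>\<close> in range is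
      \<open>0\<close>, and then \<open>(n - \<bar>\<mu>\<bar>) div 2\<close> is \<open>1\<close>,
      which is odd.\<close>
    have AG: "?A = {}" "?G = {}"
    proof -
      have none: "\<not> [(int n - \<bar>\<mu>\<bar>) div 2 = 0] (mod 2)"
        if "- int n < \<mu>" "\<mu> < int n" "[\<mu> = 0] (mod 2)" for \<mu>
      proof -
        have "\<mu> = 0" using that unfolding \<open>n = 2\<close> cong_def by presburger
        then show ?thesis by (simp add: \<open>n = 2\<close> cong_def)
      qed
      show "?A = {}" using none by fast
      have "- int n < \<mu>" if "0 \<le> \<mu>" for \<mu> :: int using that \<open>n = 2\<close> by simp
      with none show "?G = {}" by fast
    qed
    have "U p n // sim p = {eta_class p e | e. e \<in> {0, 1}}"
      unfolding main [OF \<open>even p\<close>] AG B by (simp only: Un_empty_left Un_empty_right)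
    then show "U p 2 // sim p = {eta_class p e | e. e \<in> {0, 1}}" by (simp only: \<open>n = 2\<close>)
  next
    assume "n > 2"
    then have "1 < m" using n by simp
    show "U p n // sim p = {delta_class p n t | t. t \<in> {1..p} \<and> t dvd p}" if "odd p"
      using delta [OF that] \<open>1 < m\<close> by simp
    show "U p n // sim p =
          {alpha_class p n t m | t m. t \<in> {1..p} \<and> t dvd p \<and> odd t \<and>
             - int n < m \<and> m < int n \<and> [m = 0] (mod 2) \<and> [(int n - \<bar>m\<bar>) div 2 = 0] (mod 2)} \<union>
          {beta_class p n t e | t e. t \<in> {1..p} \<and> t dvd p \<and> even t \<and> odd (p div t) \<and>
             e \<in> {0, 1}} \<union>
          {gamma_class p n t e m | t e m. t \<in> {1..p} \<and> t dvd p \<and> even t \<and> even (p div t) \<and>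
             e \<in> {0, 1} \<and>
             0 \<le> m \<and> m < int n \<and> [m = 0] (mod 2) \<and> [(int n - \<bar>m\<bar>) div 2 = 0] (mod 2)}"
      if "even p"
      using main [OF that] \<open>1 < m\<close> by simp
  qed
qed

end
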